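(* Let $G$ be a compact Lie group with Lie algebra $\mathfrak{g}$, let $\phi:G\to\mathbb{R}$ be a potential with a minimum at $g_{\text{target}}\in G$, let $b\in\mathbb{R}$, let $k_P>0$, and let $u^l_B:G\to\mathfrak{g}$ be a configuration-dependent input bias. Consider the second-order system on $G$ $$L_{g^{-1}}\tfrac{d}{dt}g=\xi^l,\qquad \tfrac{d}{dt}\xi^l=b\,\xi^l+u^l+u^l_B(g),$$ with the PID controller $$u^l=-k_P\,\mathrm{grad}^l_g\phi-k_D\,\xi^l+k_I\,u^l_I,\qquad \tfrac{d}{dt}u^l_I=-k_P\,\mathrm{grad}^l_g\phi-k_D\,\xi^l .$$ If the bias $u^l_B(g)$ has a bounded gradient with respect to $g$, then at least for $k_I>0$ and $k_D-k_I>0$ both large enough, the configuration $g$ converges to the set of critical points of $\phi$, with $\xi^l=0$ and $k_I u^l_I=-u^l_B(g)$. Only the minima of $\phi$ are stable equilibria.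
   Context: $L_{g^{-1}}$ denotes left translation of tangent vectors from $T_gG$ to the tangent space at the identity, i.e. the Lie algebra $\mathfrak{g}$; thus $\xi^l\in\mathfrak{g}$ is the left-invariant velocity, and $u^l$ (control input), $u^l_B$ (bias on this input) and $u^l_I$ (integral of the other control inputs) belong to $\mathfrak{g}$. The Lie algebra is equipped with an inner product, denoted by a dot. The left-invariant gradient $\mathrm{grad}^l_g\phi\in\mathfrak{g}$ is defined by $\tfrac{d}{dt}\phi(g(t))=\mathrm{grad}^l_g\phi\cdot\xi^l$ along any curve with $L_{g^{-1}}\tfrac{d}{dt}g=\xi^l$. Similarly the gradient $\mathrm{grad}^l_g u^l_B$ is the linear map (matrix) on $\mathfrak{g}$ such that $\tfrac{d}{dt}u^l_B(g(t))=\mathrm{grad}^l_g u^l_B\cdot\xi^l$ along such a curve. The bias $u^l_B$ depends on $g$ but not explicitly on time. The gains $k_P,k_I,k_D$ are constants. The equilibria are the points $(g,\xi^l,u^l_I)$ with $g$ a critical point of $\phi$, $\xi^l=0$ and $k_Iu^l_I=-u^l_B(g)$; an equilibrium is referred to by its configuration $g$.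
   Formalization: "Only the minima are stable" is proved for asymptotically stable equilibria; for merely Lyapunov stable ones it is proved if all critical points near the equilibrium have the same value of φ, since it fails for some smooth φ whose critical values accumulate there. *)

theory Defs
  imports "HOL-Analysis.Analysis" "HOL-Algebra.Group"
begin

section \<open>Smooth maps and Lie groups\<close>

text \<open>Iterated directional derivatives of every order up to \<open>k\<close> exist and are continuous.
  Only used on open sets of Euclidean spaces, where this is the usual class of
  \<open>k\<close> times continuously differentiable maps.\<close>

primrec Ck_on :: "nat \<Rightarrow> 'a::real_normed_vector set \<Rightarrow> ('a \<Rightarrow> 'b::real_normed_vector) \<Rightarrow> bool" where
  "Ck_on 0 S f \<longleftrightarrow> continuous_on S f"
| "Ck_on (Suc k) S f \<longleftrightarrow>
     (\<forall>x\<in>S. f differentiable (at x)) \<and> (\<forall>v. Ck_on k S (\<lambda>x. frechet_derivative f (at x) v))"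

definition smooth_on :: "'a::real_normed_vector set \<Rightarrow> ('a \<Rightarrow> 'b::real_normed_vector) \<Rightarrow> bool" where
  "smooth_on S f \<longleftrightarrow> open S \<and> (\<forall>k. Ck_on k S f)"

text \<open>A chart is a pair of a domain and a coordinate map; values of the coordinate map
  outside the domain carry no information.\<close>

type_synonym ('g, 'a) chart = "'g set \<times> ('g \<Rightarrow> 'a)"

definition is_chart :: "'g topology \<Rightarrow> ('g, 'a::real_normed_vector) chart \<Rightarrow> bool" where
  "is_chart X = (\<lambda>(U, c). openin X U \<and> open (c ` U) \<and>
     homeomorphic_map (subtopology X U) (top_of_set (c ` U)) c)"

definition smooth_atlas :: "'g topology \<Rightarrow> ('g, 'a::real_normed_vector) chart set \<Rightarrow> bool" where
  "smooth_atlas X A \<longleftrightarrow>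
     (\<forall>C\<in>A. is_chart X C) \<and> (\<Union>(U, c)\<in>A. U) = topspace X \<and>
     (\<forall>(U, c)\<in>A. \<forall>(V, d)\<in>A. smooth_on (c ` (U \<inter> V)) (d \<circ> inv_into U c))"

definition smooth_map ::
  "'g topology \<Rightarrow> ('g, 'a::real_normed_vector) chart set \<Rightarrow>
   'h topology \<Rightarrow> ('h, 'b::real_normed_vector) chart set \<Rightarrow> ('g \<Rightarrow> 'h) \<Rightarrow> bool" where
  "smooth_map X A Y B f \<longleftrightarrow> continuous_map X Y f \<and>
     (\<forall>(U, c)\<in>A. \<forall>(V, d)\<in>B. smooth_on (c ` (U \<inter> f -` V)) (d \<circ> f \<circ> inv_into U c))"

definition prod_atlas ::
  "('g, 'a) chart set \<Rightarrow> ('h, 'b) chart set \<Rightarrow> ('g \<times> 'h, 'a \<times> 'b) chart set" where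
  "prod_atlas A B = {(U \<times> V, map_prod c d) | U c V d. (U, c) \<in> A \<and> (V, d) \<in> B}"

definition smooth_potential ::
  "'g topology \<Rightarrow> ('g, 'a::real_normed_vector) chart set \<Rightarrow> ('g \<Rightarrow> real) \<Rightarrow> bool" where
  "smooth_potential X A \<phi> \<longleftrightarrow> smooth_map X A euclideanreal {(UNIV, \<lambda>x. x)} \<phi>"

locale lie_group = group G
  for G :: "('g, 'm) monoid_scheme" (structure) +
  fixes X :: "'g topology" and A :: "('g, 'a::euclidean_space) chart set"
  assumes topspace_eq: "topspace X = carrier G"
    and Hausdorff: "Hausdorff_space X"
    and second_countable: "second_countable X"
    and atlas: "smooth_atlas X A"
    and smooth_mult: "smooth_map (prod_topology X X) (prod_atlas A A) X A (\<lambda>(x, y). x \<otimes> y)"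
    and smooth_inv: "smooth_map X A X A (\<lambda>x. inv x)"

locale compact_lie_group = lie_group +
  assumes compact: "compact_space X"

definition local_minimum :: "'g topology \<Rightarrow> ('g \<Rightarrow> real) \<Rightarrow> 'g \<Rightarrow> bool" where
  "local_minimum X \<phi> p \<longleftrightarrow> (\<exists>W. openin X W \<and> p \<in> W \<and> (\<forall>q\<in>W. \<phi> p \<le> \<phi> q))"


section \<open>Left-invariant velocities and gradients\<close>

text \<open>In all that follows \<open>\<kappa>\<close> is the coordinate map of a chart around the identity. Its
  differential at the identity identifies the Lie algebra (the tangent space at the identity)
  with the Euclidean space \<open>'a\<close>, and the inner product of \<open>'a\<close> is the one on the
  Lie algebra. As \<open>\<kappa>\<close> may be composed with any linear isomorphism, every inner product
  on the Lie algebra arises in this way.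

  The left translate to the identity of the tangent vector of \<open>\<gamma>\<close> at time \<open>t\<close> is the tangent
  vector at time \<open>t\<close> of the translated curve \<open>\<lambda>s. inv (\<gamma> t) \<otimes> \<gamma> s\<close>, which passes through the
  identity at that time; \<open>\<xi>\<close> below is its coordinate expression. Continuity of \<open>\<gamma>\<close> at \<open>t\<close> has
  to be required because \<open>\<kappa>\<close> is arbitrary outside its domain.\<close>

definition has_left_velocity ::
  "('g, 'm) monoid_scheme \<Rightarrow> 'g topology \<Rightarrow> ('g \<Rightarrow> 'a::euclidean_space) \<Rightarrow>
   (real \<Rightarrow> 'g) \<Rightarrow> 'a \<Rightarrow> real \<Rightarrow> real set \<Rightarrow> bool" where
  "has_left_velocity G X \<kappa> \<gamma> \<xi> t T \<longleftrightarrow>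
     limitin X \<gamma> (\<gamma> t) (at t within T) \<and>
     ((\<lambda>s. \<kappa> (inv\<^bsub>G\<^esub> (\<gamma> t) \<otimes>\<^bsub>G\<^esub> \<gamma> s)) has_vector_derivative \<xi>) (at t within T)"

definition has_left_derivative ::
  "('g, 'm) monoid_scheme \<Rightarrow> 'g topology \<Rightarrow> ('g \<Rightarrow> 'a::euclidean_space) \<Rightarrow>
   ('g \<Rightarrow> 'b::real_normed_vector) \<Rightarrow> ('a \<Rightarrow> 'b) \<Rightarrow> 'g \<Rightarrow> bool" where
  "has_left_derivative G X \<kappa> f D p \<longleftrightarrow> bounded_linear D \<and>
     (\<forall>\<gamma> t \<xi>. \<gamma> t = p \<and> has_left_velocity G X \<kappa> \<gamma> \<xi> t UNIV \<longrightarrow>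
        ((\<lambda>s. f (\<gamma> s)) has_vector_derivative D \<xi>) (at t))"

definition left_grad ::
  "('g, 'm) monoid_scheme \<Rightarrow> 'g topology \<Rightarrow> ('g \<Rightarrow> 'a::euclidean_space) \<Rightarrow>
   ('g \<Rightarrow> real) \<Rightarrow> 'g \<Rightarrow> 'a" where
  "left_grad G X \<kappa> \<phi> p = (THE v. has_left_derivative G X \<kappa> \<phi> (\<lambda>\<xi>. v \<bullet> \<xi>) p)"

definition has_bounded_left_gradient ::
  "('g, 'm) monoid_scheme \<Rightarrow> 'g topology \<Rightarrow> ('g \<Rightarrow> 'a::euclidean_space) \<Rightarrow> ('g \<Rightarrow> 'a) \<Rightarrow> bool" where
  "has_bounded_left_gradient G X \<kappa> uB \<longleftrightarrow>
     (\<exists>D B. \<forall>p\<in>carrier G. has_left_derivative G X \<kappa> uB (D p) p \<and> onorm (D p) \<le> B)"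

definition critical_points ::
  "('g, 'm) monoid_scheme \<Rightarrow> 'g topology \<Rightarrow> ('g \<Rightarrow> 'a::euclidean_space) \<Rightarrow> ('g \<Rightarrow> real) \<Rightarrow> 'g set" where
  "critical_points G X \<kappa> \<phi> = {p \<in> carrier G. left_grad G X \<kappa> \<phi> p = 0}"


section \<open>The controlled system\<close>

definition pid_control ::
  "('g, 'm) monoid_scheme \<Rightarrow> 'g topology \<Rightarrow> ('g \<Rightarrow> 'a::euclidean_space) \<Rightarrow> ('g \<Rightarrow> real) \<Rightarrow>
   real \<Rightarrow> real \<Rightarrow> real \<Rightarrow> 'g \<Rightarrow> 'a \<Rightarrow> 'a \<Rightarrow> 'a" where
  "pid_control G X \<kappa> \<phi> kP kI kD p x v =
     - kP *\<^sub>R left_grad G X \<kappa> \<phi> p - kD *\<^sub>R x + kI *\<^sub>R v"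

definition closed_loop_solution ::
  "('g, 'm) monoid_scheme \<Rightarrow> 'g topology \<Rightarrow> ('g \<Rightarrow> 'a::euclidean_space) \<Rightarrow> ('g \<Rightarrow> real) \<Rightarrow>
   real \<Rightarrow> ('g \<Rightarrow> 'a) \<Rightarrow> real \<Rightarrow> real \<Rightarrow> real \<Rightarrow>
   (real \<Rightarrow> 'g) \<Rightarrow> (real \<Rightarrow> 'a) \<Rightarrow> (real \<Rightarrow> 'a) \<Rightarrow> bool" where
  "closed_loop_solution G X \<kappa> \<phi> b uB kP kI kD g \<xi> uI \<longleftrightarrow>
     (\<forall>t\<ge>0.
        has_left_velocity G X \<kappa> g (\<xi> t) t {0..} \<and>
        (\<xi> has_vector_derivative
           b *\<^sub>R \<xi> t + pid_control G X \<kappa> \<phi> kP kI kD (g t) (\<xi> t) (uI t) + uB (g t))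
          (at t within {0..}) \<and>
        (uI has_vector_derivative - kP *\<^sub>R left_grad G X \<kappa> \<phi> (g t) - kD *\<^sub>R \<xi> t)
          (at t within {0..}))"

definition equilibria ::
  "('g, 'm) monoid_scheme \<Rightarrow> 'g topology \<Rightarrow> ('g \<Rightarrow> 'a::euclidean_space) \<Rightarrow> ('g \<Rightarrow> real) \<Rightarrow>
   ('g \<Rightarrow> 'a) \<Rightarrow> real \<Rightarrow> ('g \<times> 'a \<times> 'a) set" where
  "equilibria G X \<kappa> \<phi> uB kI =
     {(p, x, v). p \<in> critical_points G X \<kappa> \<phi> \<and> x = 0 \<and> kI *\<^sub>R v = - uB p}"


section \<open>Convergence to a set and stability\<close>

definition tends_to_set :: "'g topology \<Rightarrow> ('t \<Rightarrow> 'g) \<Rightarrow> 'g set \<Rightarrow> 't filter \<Rightarrow> bool" where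
  "tends_to_set X f C F \<longleftrightarrow> (\<forall>W. openin X W \<and> C \<subseteq> W \<longrightarrow> eventually (\<lambda>t. f t \<in> W) F)"

text \<open>Stability notions for a system given by the set \<open>Sol\<close> of its forward trajectories in the
  state space \<open>S\<close>. Lyapunov stability includes that trajectories exist for all forward time
  from states near \<open>z\<close>; without this clause it would hold vacuously where there are none.\<close>

definition lyapunov_stable :: "'s topology \<Rightarrow> (real \<Rightarrow> 's) set \<Rightarrow> 's \<Rightarrow> bool" where
  "lyapunov_stable S Sol z \<longleftrightarrow>
     (\<forall>W. openin S W \<and> z \<in> W \<longrightarrow>
        (\<exists>V. openin S V \<and> z \<in> V \<and>
           (\<forall>z0\<in>V. \<exists>\<zeta>\<in>Sol. \<zeta> 0 = z0) \<and>
           (\<forall>\<zeta>\<in>Sol. \<zeta> 0 \<in> V \<longrightarrow> (\<forall>t\<ge>0. \<zeta> t \<in> W))))"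

definition asymptotically_stable :: "'s topology \<Rightarrow> (real \<Rightarrow> 's) set \<Rightarrow> 's \<Rightarrow> bool" where
  "asymptotically_stable S Sol z \<longleftrightarrow> lyapunov_stable S Sol z \<and>
     (\<exists>V. openin S V \<and> z \<in> V \<and> (\<forall>\<zeta>\<in>Sol. \<zeta> 0 \<in> V \<longrightarrow> limitin S \<zeta> z at_top))"

definition state_space :: "'g topology \<Rightarrow> ('g \<times> 'a::euclidean_space \<times> 'a) topology" where
  "state_space X = prod_topology X (prod_topology euclidean euclidean)"

definition closed_loop_trajectories ::
  "('g, 'm) monoid_scheme \<Rightarrow> 'g topology \<Rightarrow> ('g \<Rightarrow> 'a::euclidean_space) \<Rightarrow> ('g \<Rightarrow> real) \<Rightarrow>
   real \<Rightarrow> ('g \<Rightarrow> 'a) \<Rightarrow> real \<Rightarrow> real \<Rightarrow> real \<Rightarrow> (real \<Rightarrow> 'g \<times> 'a \<times> 'a) set" where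
  "closed_loop_trajectories G X \<kappa> \<phi> b uB kP kI kD =
     {\<lambda>t. (g t, \<xi> t, uI t) | g \<xi> uI. closed_loop_solution G X \<kappa> \<phi> b uB kP kI kD g \<xi> uI}"

text \<open>Near \<open>p\<close> no critical value other than \<open>\<phi> p\<close> occurs. This holds at isolated critical points,
  hence for Morse functions, and for Morse-Bott and analytic functions.\<close>

definition critical_value_locally_constant ::
  "('g, 'm) monoid_scheme \<Rightarrow> 'g topology \<Rightarrow> ('g \<Rightarrow> 'a::euclidean_space) \<Rightarrow> ('g \<Rightarrow> real) \<Rightarrow> 'g \<Rightarrow> bool" where
  "critical_value_locally_constant G X \<kappa> \<phi> p \<longleftrightarrow>
     (\<exists>W. openin X W \<and> p \<in> W \<and> (\<forall>q \<in> W \<inter> critical_points G X \<kappa> \<phi>. \<phi> q = \<phi> p))"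

end

theory Submission
  imports Defs
begin

text \<open>Put \<open>z = kI *\<^sub>R uI + uB g - kI *\<^sub>R \<xi>\<close>. Then \<open>z' = - kI *\<^sub>R z + O(norm \<xi>)\<close> and
  \<open>\<xi>' = - (kD - kI - b) *\<^sub>R \<xi> - kP *\<^sub>R grad + z\<close>, so for large gains
  \<open>V = kP * \<phi> g + (norm \<xi>)\<^sup>2 / 2 + (norm z)\<^sup>2 / (2 * kI\<^sup>2)\<close> decreases at a rate of at least a
  multiple of \<open>(norm \<xi>)\<^sup>2 + (norm z)\<^sup>2\<close>. Barbalat's lemma gives \<open>\<xi> \<longlongrightarrow> 0\<close> and \<open>z \<longlongrightarrow> 0\<close>, then
  \<open>\<xi>' \<longlongrightarrow> 0\<close>, and hence the gradient tends to \<open>0\<close>; here the gradient of the smooth potential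
  has itself a bounded left gradient, by compactness of the group. If an equilibrium is not at a
  local minimum, then arbitrarily near to it there are rest points with \<open>z = 0\<close> and a smaller
  potential; the trajectories from there keep a smaller potential, because \<open>V\<close> decreases.\<close>

section \<open>Dissipation and Barbalat's lemma\<close>

text \<open>The mean value inequality on the half line. Derivatives are asked for at positive times
  only, and continuity reaches the endpoint 0, where trajectories have one-sided
  derivatives.\<close>

lemma bounded_derivative_lipschitz:
  fixes f :: "real \<Rightarrow> 'a::real_normed_vector"
  assumes "continuous_on {0..} f"
    and "\<And>t. t > 0 \<Longrightarrow> \<exists>d. (f has_vector_derivative d) (at t) \<and> norm d \<le> M"
    and "0 \<le> s" "s \<le> t"
  shows "norm (f t - f s) \<le> M * (t - s)"
proof (cases "s = t")
  case False
  obtain f' where f': "\<And>t. t > 0 \<Longrightarrow> (f has_vector_derivative f' t) (at t) \<and> norm (f' t) \<le> M"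
    using assms(2) by metis
  have "norm (f t - f s) \<le> M * t - M * s"
  proof (rule differentiable_bound_general)
    show "continuous_on {s..t} f" using assms by (auto intro: continuous_on_subset)
    show "continuous_on {s..t} (\<lambda>t. M * t)" by (intro continuous_intros)
    show "(f has_vector_derivative f' x) (at x)" if "s < x" for x using f' that assms by auto
    show "((\<lambda>t. M * t) has_vector_derivative M) (at x)" for x
      by (auto intro!: derivative_eq_intros simp: has_real_derivative_iff_has_vector_derivative[symmetric])
    show "norm (f' x) \<le> M" if "s < x" for x using f' that assms by auto
  qed (use False assms in auto)
  then show ?thesis by (simp add: algebra_simps)
qed auto

text \<open>Take for \<open>T\<close> a time at which \<open>V\<close> is within \<open>e\<close> of
  its infimum over \<open>{0..}\<close>: later values stay between the infimum and
  \<open>V T\<close>.\<close>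

lemma decreasing_bounded_below_Cauchy:
  fixes V :: "real \<Rightarrow> real"
  assumes mono: "\<And>s t. 0 \<le> s \<Longrightarrow> s \<le> t \<Longrightarrow> V t \<le> V s"
    and below: "\<And>t. 0 \<le> t \<Longrightarrow> m \<le> V t" and "e > 0"
  shows "\<exists>T\<ge>0. \<forall>s\<ge>T. \<forall>t\<ge>T. V s - V t < e"
proof -
  have bb: "bdd_below (V ` {0..})" using below by (intro bdd_belowI[of _ m]) auto
  have "\<exists>y\<in>V ` {0..}. y < Inf (V ` {0..}) + e"
    using \<open>e > 0\<close> by (intro cInf_lessD) auto
  then obtain T where T: "T \<ge> 0" "V T < Inf (V ` {0..}) + e" by auto
  have "V s - V t < e" if "s \<ge> T" "t \<ge> T" for s t
    using mono[of T s] cInf_lower[OF _ bb, of "V t"] that T by auto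
  then show ?thesis using T by blast
qed

text \<open>Barbalat's lemma in a form without integrals: whenever \<open>f t \<ge> e\<close>, the Lipschitz condition
  keeps \<open>f\<close> above \<open>e / 2\<close> for a fixed time, so that \<open>V\<close> drops by a fixed amount.\<close>

lemma dissipation_tendsto_0:
  fixes V f :: "real \<Rightarrow> real"
  assumes contV: "continuous_on {0..} V"
    and dV: "\<And>t. t > 0 \<Longrightarrow> \<exists>d. (V has_real_derivative d) (at t) \<and> d \<le> - c * f t"
    and below: "\<And>t. 0 \<le> t \<Longrightarrow> m \<le> V t"
    and f0: "\<And>t. 0 \<le> t \<Longrightarrow> 0 \<le> f t"
    and lip: "\<And>s t. 0 \<le> s \<Longrightarrow> s \<le> t \<Longrightarrow> \<bar>f t - f s\<bar> \<le> M * (t - s)"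
    and "c > 0"
  shows "(f \<longlongrightarrow> 0) at_top"
proof (rule tendstoI)
  fix e :: real assume "e > 0"
  \<comment> \<open>Since \<open>M\<close> may be 0, a positive Lipschitz constant \<open>L\<close>
    takes its place; within the time \<open>d\<close> below, \<open>f\<close> then falls by at most
    \<open>e / 2\<close>.\<close>
  define L where "L = \<bar>M\<bar> + 1"
  have L: "L > 0" "M \<le> L" by (auto simp: L_def)
  define d where "d = e / (2 * L)"
  have d: "d > 0" using \<open>e > 0\<close> L by (simp add: d_def)
  have mono: "V t \<le> V s" if "0 \<le> s" "s \<le> t" for s t
  proof (rule DERIV_nonpos_imp_decreasing_open[where f = V])
    show "\<exists>y. (V has_real_derivative y) (at x) \<and> y \<le> 0" if "s < x" for x
    proof -
      have "x > 0" using that \<open>0 \<le> s\<close> by simp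
      then obtain y where "(V has_real_derivative y) (at x)" "y \<le> - c * f x"
        using dV by blast
      moreover have "c * f x \<ge> 0" using f0[of x] \<open>c > 0\<close> that \<open>0 \<le> s\<close> by auto
      ultimately show ?thesis by auto
    qed
    show "continuous_on {s..t} V" using contV that by (auto intro: continuous_on_subset)
  qed (use that in auto)
  have drop: "V t - V (t + d) \<ge> c * (e / 2) * d" if t: "t \<ge> 0" "f t \<ge> e" for t
  proof -
    \<comment> \<open>On the window of length \<open>d\<close> the slope of \<open>V\<close> is at
      most \<open>- c * (e / 2)\<close>, so \<open>V\<close> still decreases after a linear term of
      the opposite slope has been added.\<close>
    have "V (t + d) + c * (e / 2) * (t + d) \<le> V t + c * (e / 2) * t"
    proof (rule DERIV_nonpos_imp_decreasing_open[where f = "\<lambda>t. V t + c * (e / 2) * t"])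
      show "\<exists>y. ((\<lambda>t. V t + c * (e / 2) * t) has_real_derivative y) (at x) \<and> y \<le> 0"
        if x: "t < x" "x < t + d" for x
      proof -
        have "x > 0" using x t by simp
        then obtain y where y: "(V has_real_derivative y) (at x)" "y \<le> - c * f x"
          using dV by blast
        have "M * (x - t) \<le> L * d"
          using L x by (intro mult_mono) auto
        also have "L * d = e / 2" using L by (simp add: d_def)
        finally have "f x \<ge> e / 2" using lip[of t x] x t by auto
        then have "c * f x \<ge> c * (e / 2)" using \<open>c > 0\<close> by (intro mult_left_mono) auto
        moreover have "((\<lambda>t. V t + c * (e / 2) * t) has_real_derivative (y + c * (e/2))) (at x)"
          by (auto intro!: derivative_eq_intros y)
        ultimately show ?thesis using y by (intro exI[of _ "y + c * (e/2)"]) auto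
      qed
      show "continuous_on {t..t + d} (\<lambda>t. V t + c * (e / 2) * t)"
        using t by (intro continuous_intros continuous_on_subset[OF contV]) auto
    qed (use d in auto)
    then show ?thesis by argo
  qed
  have "c * (e / 2) * d > 0" using \<open>c > 0\<close> \<open>e > 0\<close> d by simp
  then have "\<exists>T\<ge>0. \<forall>s\<ge>T. \<forall>t\<ge>T. V s - V t < c * (e / 2) * d"
    by (intro decreasing_bounded_below_Cauchy[of V m] mono below)
  then obtain T where T: "T \<ge> 0" "\<And>s t. s \<ge> T \<Longrightarrow> t \<ge> T \<Longrightarrow> V s - V t < c * (e / 2) * d"
    by blast
  have "f t < e" if "t \<ge> T" for t
  proof (rule ccontr)
    assume "\<not> f t < e"
    then have "V t - V (t + d) \<ge> c * (e / 2) * d" using drop[of t] that T(1) by simp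
    moreover have "V t - V (t + d) < c * (e / 2) * d" using T(2)[of t "t + d"] that d by simp
    ultimately show False by simp
  qed
  then show "\<forall>\<^sub>F t in at_top. dist (f t) 0 < e"
    unfolding eventually_at_top_linorder using T f0 by (intro exI[of _ T]) (auto simp: dist_real_def)
qed

text \<open>The second form of Barbalat's lemma. As \<open>y\<close> is Lipschitz, it is nearly
  constant on a short window of fixed length \<open>s\<close>, so the increment of \<open>x\<close>
  there is close to \<open>s *\<^sub>R y t\<close>; the increments vanish, hence so does
  \<open>y\<close>.\<close>

lemma derivative_tendsto_0:
  fixes x y :: "real \<Rightarrow> 'a::real_normed_vector"
  assumes contx: "continuous_on {0..} x"
    and dx: "\<And>t. t > 0 \<Longrightarrow> (x has_vector_derivative y t) (at t)"
    and lip: "\<And>s t. 0 \<le> s \<Longrightarrow> s \<le> t \<Longrightarrow> norm (y t - y s) \<le> M * (t - s)"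
    and lim: "(x \<longlongrightarrow> 0) at_top"
  shows "(y \<longlongrightarrow> 0) at_top"
proof (rule tendstoI)
  fix e :: real assume "e > 0"
  define L where "L = \<bar>M\<bar> + 1"
  have L: "L > 0" "M \<le> L" by (auto simp: L_def)
  define s where "s = e / (2 * L)"
  have s: "s > 0" "L * s = e / 2" using \<open>e > 0\<close> L by (auto simp: s_def)
  have est: "s * norm (y t) \<le> norm (x (t + s)) + norm (x t) + s * (e / 2)" if "t > 0" for t
  proof -
    \<comment> \<open>Subtracting \<open>r *\<^sub>R y t\<close> from \<open>x r\<close> leaves a
      function with derivative \<open>y r - y t\<close>, which is at most \<open>e / 2\<close> in
      norm on the window.\<close>
    have "norm ((x (t + s) - (t + s) *\<^sub>R y t) - (x t - t *\<^sub>R y t)) \<le> (e / 2) * (t + s) - (e / 2) * t"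
    proof (rule differentiable_bound_general)
      show "continuous_on {t..t + s} (\<lambda>r. x r - r *\<^sub>R y t)"
        using that by (intro continuous_intros continuous_on_subset[OF contx]) auto
      show "((\<lambda>r. x r - r *\<^sub>R y t) has_vector_derivative (y r - y t)) (at r)" if "t < r" for r
        using \<open>t > 0\<close> that by (auto intro!: derivative_eq_intros dx)
      show "((\<lambda>t. (e / 2) * t) has_vector_derivative (e / 2)) (at r)" for r
        by (auto intro!: derivative_eq_intros simp: has_real_derivative_iff_has_vector_derivative[symmetric])
      show "norm (y r - y t) \<le> e / 2" if "t < r" "r < t + s" for r
      proof -
        have "norm (y r - y t) \<le> M * (r - t)" using lip[of t r] \<open>t > 0\<close> that by auto
        also have "\<dots> \<le> L * s" using L that by (intro mult_mono) auto
        finally show ?thesis using s by simp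
      qed
    qed (use s in \<open>auto intro!: continuous_intros\<close>)
    moreover have "(x (t + s) - (t + s) *\<^sub>R y t) - (x t - t *\<^sub>R y t) = (x (t + s) - x t) - s *\<^sub>R y t"
      by (simp add: algebra_simps)
    ultimately have "norm ((x (t + s) - x t) - s *\<^sub>R y t) \<le> s * (e / 2)" by (simp add: algebra_simps)
    moreover have "norm (s *\<^sub>R y t) = s * norm (y t)" using s by simp
    moreover have "norm (s *\<^sub>R y t) \<le> norm ((x (t + s) - x t) - s *\<^sub>R y t) + norm (x (t + s) - x t)"
      by (metis norm_minus_commute norm_triangle_sub add.commute)
    moreover have "norm (x (t + s) - x t) \<le> norm (x (t + s)) + norm (x t)" by (rule norm_triangle_ineq4)
    ultimately show ?thesis by linarith
  qed
  have "s * (e / 4) > 0" using s \<open>e > 0\<close> by simp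
  from tendstoD[OF lim this] obtain T where T: "\<And>t. t \<ge> T \<Longrightarrow> norm (x t) < s * (e / 4)"
    unfolding eventually_at_top_linorder by auto
  have "norm (y t) < e" if "t \<ge> max T 1" for t
  proof -
    have "s * norm (y t) < s * e"
    proof -
      have "norm (x t) < s * (e / 4)" "norm (x (t + s)) < s * (e / 4)" using T that s by auto
      moreover have "s * e = s * (e / 4) + s * (e / 4) + s * (e / 2)" by (simp add: field_simps)
      ultimately show ?thesis using est[of t] that by linarith
    qed
    then show ?thesis using s by simp
  qed
  then show "\<forall>\<^sub>F t in at_top. dist (y t) 0 < e"
    unfolding eventually_at_top_linorder by (intro exI[of _ "max T 1"]) auto
qed

text \<open>The group is eliminated: \<open>h\<close>, \<open>\<beta>\<close> and
  \<open>\<psi>\<close> stand for the gradient, the bias and the potential along a trajectory. What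
  remains of the geometry are the chain rules \<open>d\<psi>\<close>, \<open>d\<beta>\<close>,
  \<open>dh\<close> and the bounds that compactness provides.\<close>

locale pid_signals =
  fixes x u h \<beta> :: "real \<Rightarrow> 'a::real_inner" and \<psi> :: "real \<Rightarrow> real"
    and b kP kI kD B H L m :: real
  assumes cont: "continuous_on {0..} x" "continuous_on {0..} u" "continuous_on {0..} h"
      "continuous_on {0..} \<beta>" "continuous_on {0..} \<psi>"
    and dx: "\<And>t. t > 0 \<Longrightarrow>
      (x has_vector_derivative b *\<^sub>R x t + (- kP *\<^sub>R h t - kD *\<^sub>R x t + kI *\<^sub>R u t) + \<beta> t) (at t)"
    and du: "\<And>t. t > 0 \<Longrightarrow> (u has_vector_derivative - kP *\<^sub>R h t - kD *\<^sub>R x t) (at t)"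
    and d\<psi>: "\<And>t. t > 0 \<Longrightarrow> (\<psi> has_real_derivative h t \<bullet> x t) (at t)"
    and d\<beta>: "\<And>t. t > 0 \<Longrightarrow> \<exists>d. (\<beta> has_vector_derivative d) (at t) \<and> norm d \<le> B * norm (x t)"
    and dh: "\<And>t. t > 0 \<Longrightarrow> \<exists>d. (h has_vector_derivative d) (at t) \<and> norm d \<le> H * norm (x t)"
    and h_bound: "\<And>t. 0 \<le> t \<Longrightarrow> norm (h t) \<le> L"
    and \<psi>_bound: "\<And>t. 0 \<le> t \<Longrightarrow> m \<le> \<psi> t"
    and gains: "kP > 0" "kI \<ge> 1" "B \<ge> 0" "H \<ge> 0" "kD - kI \<ge> \<bar>b\<bar> + (B + \<bar>b\<bar>)\<^sup>2 + 1"
begin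

section \<open>The Lyapunov function and its dissipation\<close>

definition z :: "real \<Rightarrow> 'a" where "z t = kI *\<^sub>R u t + \<beta> t - kI *\<^sub>R x t"

definition V :: "real \<Rightarrow> real" where
  "V t = kP * \<psi> t + (x t \<bullet> x t) / 2 + (z t \<bullet> z t) / (2 * kI\<^sup>2)"

text \<open>Subtracting \<open>kI *\<^sub>R x\<close> in \<open>z\<close> cancels the gradient from its derivative.\<close>

lemma dx': "t > 0 \<Longrightarrow> (x has_vector_derivative (b - kD + kI) *\<^sub>R x t - kP *\<^sub>R h t + z t) (at t)"
  using dx[of t] by (simp add: z_def algebra_simps)

text \<open>The derivative of \<open>u\<close> cancels in that of
  \<open>kI *\<^sub>R (u - x)\<close>, which leaves
  \<open>- kI *\<^sub>R (z + kI *\<^sub>R x + b *\<^sub>R x)\<close>. The derivative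
  \<open>d\<close> of \<open>\<beta>\<close> is known by its bound alone and is grouped with the
  \<open>b\<close> term as a perturbation.\<close>

lemma dz:
  assumes "t > 0"
  shows "\<exists>d. (z has_vector_derivative - kI *\<^sub>R z t - kI\<^sup>2 *\<^sub>R x t + (d - (kI * b) *\<^sub>R x t)) (at t)
    \<and> norm d \<le> B * norm (x t)"
proof -
  obtain d where d: "(\<beta> has_vector_derivative d) (at t)" "norm d \<le> B * norm (x t)"
    using d\<beta> assms by blast
  have "(z has_vector_derivative - kI *\<^sub>R z t - kI\<^sup>2 *\<^sub>R x t + (d - (kI * b) *\<^sub>R x t)) (at t)"
    unfolding z_def
    by (auto intro!: derivative_eq_intros dx du d assms simp: algebra_simps power2_eq_square)
  then show ?thesis using d by blast
qed

lemma cont_z: "continuous_on {0..} z"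
  unfolding z_def by (intro continuous_intros cont)

lemma cont_V: "continuous_on {0..} V"
  unfolding V_def by (intro continuous_intros cont cont_z) (use gains in auto)

text \<open>The gradient terms of potential and kinetic energy cancel. The weight
  \<open>1 / kI\<^sup>2\<close> on \<open>z \<bullet> z\<close> makes the coupling
  \<open>- kI\<^sup>2 *\<^sub>R x\<close> in the derivative of \<open>z\<close> cancel the term
  \<open>x \<bullet> z\<close> from the derivative of \<open>x\<close>. Beside negative squares only
  the perturbation of \<open>dz\<close> is left, and Young's inequality absorbs it.\<close>

lemma dV:
  assumes "t > 0"
  shows "\<exists>d. (V has_real_derivative d) (at t) \<and>
    d \<le> - (1 / (2 * kI)) * ((norm (x t))\<^sup>2 + (norm (z t))\<^sup>2)"
proof -
  obtain d where dz: "(z has_vector_derivative - kI *\<^sub>R z t - kI\<^sup>2 *\<^sub>R x t + (d - (kI * b) *\<^sub>R x t)) (at t)"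
    and d: "norm d \<le> B * norm (x t)"
    using dz assms by blast
  have kI: "kI > 0" using gains by simp
  let ?x' = "(b - kD + kI) *\<^sub>R x t - kP *\<^sub>R h t + z t"
  let ?z' = "- kI *\<^sub>R z t - kI\<^sup>2 *\<^sub>R x t + (d - (kI * b) *\<^sub>R x t)"
  have D: "((\<lambda>t. (f t \<bullet> f t)) has_real_derivative 2 * (f t \<bullet> f')) (at t)"
    if "(f has_vector_derivative f') (at t)" for f :: "real \<Rightarrow> 'a" and f'
    using bounded_bilinear.has_vector_derivative[OF bounded_bilinear_inner that that]
    by (simp add: has_real_derivative_iff_has_vector_derivative inner_commute)
  have V': "(V has_real_derivative kP * (h t \<bullet> x t) + (x t \<bullet> ?x') + (z t \<bullet> ?z') / kI\<^sup>2) (at t)"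
    unfolding V_def
    using DERIV_add[OF DERIV_add[OF DERIV_cmult[OF d\<psi>[OF assms]] DERIV_cdivide[OF D[OF dx'[OF assms]]]]
      DERIV_cdivide[OF D[OF dz]], of kP 2 "2 * kI\<^sup>2"]
    by simp
  define X Z where "X = norm (x t)" and "Z = norm (z t)"
  have XZ: "X \<ge> 0" "Z \<ge> 0" "x t \<bullet> x t = X\<^sup>2" "z t \<bullet> z t = Z\<^sup>2"
    by (auto simp: X_def Z_def power2_norm_eq_inner)
  have "kP * (h t \<bullet> x t) + (x t \<bullet> ?x') + (z t \<bullet> ?z') / kI\<^sup>2
      = - (kD - kI - b) * X\<^sup>2 - Z\<^sup>2 / kI + (z t \<bullet> (d - (kI * b) *\<^sub>R x t)) / kI\<^sup>2"
    using kI by (simp add: inner_add_right inner_diff_right XZ inner_commute[of "h t"] inner_commute[of "z t" "x t"])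
      (simp add: field_simps power2_eq_square)
  also have "z t \<bullet> (d - (kI * b) *\<^sub>R x t) \<le> Z * (B * X + kI * \<bar>b\<bar> * X)"
  proof -
    have "norm (d - (kI * b) *\<^sub>R x t) \<le> B * X + kI * \<bar>b\<bar> * X"
      using norm_triangle_ineq4[of d "(kI * b) *\<^sub>R x t"] d kI by (simp add: X_def abs_mult)
    then have "Z * norm (d - (kI * b) *\<^sub>R x t) \<le> Z * (B * X + kI * \<bar>b\<bar> * X)"
      using XZ by (intro mult_left_mono) auto
    then show ?thesis using norm_cauchy_schwarz[of "z t" "d - (kI * b) *\<^sub>R x t"] by (simp add: Z_def)
  qed
  \<comment> \<open>From \<open>kI \<ge> 1\<close>, \<open>B\<close> is at most
    \<open>kI * B\<close>, so that one factor \<open>kI\<close> can be split off and later cancelled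
    against \<open>kI\<^sup>2\<close>.\<close>
  also have "Z * (B * X + kI * \<bar>b\<bar> * X) \<le> kI * (B + \<bar>b\<bar>) * (Z * X)"
  proof -
    have "B * (Z * X) \<le> kI * B * (Z * X)" 
      using gains XZ mult_right_mono[of 1 kI B] by (intro mult_right_mono) auto
    then show ?thesis by (simp add: algebra_simps)
  qed
  also have "kI * (B + \<bar>b\<bar>) * (Z * X) \<le> kI * ((Z\<^sup>2 + (B + \<bar>b\<bar>)\<^sup>2 * X\<^sup>2) / 2)"
  proof -
    have "(B + \<bar>b\<bar>) * (Z * X) \<le> (Z\<^sup>2 + (B + \<bar>b\<bar>)\<^sup>2 * X\<^sup>2) / 2"
      using sum_squares_bound[of Z "(B + \<bar>b\<bar>) * X"] by (simp add: power_mult_distrib mult_ac)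
    then show ?thesis using kI by (simp add: mult.assoc)
  qed
  \<comment> \<open>Young's inequality uses up half of \<open>Z\<^sup>2 / kI\<close>. The three
    summands in the bound on \<open>kD - kI\<close> pay for \<open>b\<close>, for the square of
    \<open>B + \<bar>b\<bar>\<close> and for the dissipation in \<open>X\<close>.\<close>
  also have "- (kD - kI - b) * X\<^sup>2 - Z\<^sup>2 / kI + kI * ((Z\<^sup>2 + (B + \<bar>b\<bar>)\<^sup>2 * X\<^sup>2) / 2) / kI\<^sup>2
     \<le> - (1 / (2 * kI)) * (X\<^sup>2 + Z\<^sup>2)"
  proof -
    have "y / kI \<le> y" if "y \<ge> 0" for y
      using gains mult_left_mono[of 1 kI y] that by (simp add: divide_le_eq)
    then have a: "(B + \<bar>b\<bar>)\<^sup>2 * X\<^sup>2 / kI \<le> (B + \<bar>b\<bar>)\<^sup>2 * X\<^sup>2"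
      and b: "X\<^sup>2 / kI \<le> X\<^sup>2" by simp_all
    have c: "(\<bar>b\<bar> + (B + \<bar>b\<bar>)\<^sup>2 + 1) * X\<^sup>2 \<le> (kD - kI) * X\<^sup>2"
      using gains by (intro mult_right_mono) auto
    have e: "b * X\<^sup>2 \<le> \<bar>b\<bar> * X\<^sup>2" by (intro mult_right_mono) auto
    have 1: "kI * ((Z\<^sup>2 + (B + \<bar>b\<bar>)\<^sup>2 * X\<^sup>2) / 2) / kI\<^sup>2 = Z\<^sup>2 / kI / 2 + (B + \<bar>b\<bar>)\<^sup>2 * X\<^sup>2 / kI / 2"
      using kI by (simp add: field_simps power2_eq_square)
    have 2: "- (1 / (2 * kI)) * (X\<^sup>2 + Z\<^sup>2) = - (X\<^sup>2 / kI / 2) - Z\<^sup>2 / kI / 2"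
      using kI by (simp add: field_simps)
    have 3: "- (kD - kI - b) * X\<^sup>2 = b * X\<^sup>2 - (kD - kI) * X\<^sup>2" by (simp add: algebra_simps)
    have 4: "(B + \<bar>b\<bar>)\<^sup>2 * X\<^sup>2 \<ge> 0" "X\<^sup>2 \<ge> 0" by auto
    \<comment> \<open>With every product replaced by a variable, the remaining inequality is
      linear.\<close>
    have "p - q - y + (y / 2 + r' / 2) \<le> - (v' / 2) - y / 2"
      if "r' \<le> r" "v' \<le> v" "w + r + 1 * v \<le> q" "p \<le> w" "0 \<le> r" "0 \<le> v"
      for p q r r' v v' w y :: real
      using that by linarith
    from this[OF a b c[unfolded distrib_right] e 4] show ?thesis unfolding 1 2 3 .
  qed
  finally have "kP * (h t \<bullet> x t) + (x t \<bullet> ?x') + (z t \<bullet> ?z') / kI\<^sup>2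
      \<le> - (1 / (2 * kI)) * (X\<^sup>2 + Z\<^sup>2)"
    using kI by (simp add: divide_right_mono)
  with V' show ?thesis unfolding X_def Z_def by blast
qed

section \<open>Boundedness and convergence of the signals\<close>

lemma V_decreasing:
  assumes "0 \<le> s" "s \<le> t"
  shows "V t \<le> V s"
proof (rule DERIV_nonpos_imp_decreasing_open[where f = V, OF assms(2)])
  show "\<exists>y. (V has_real_derivative y) (at r) \<and> y \<le> 0" if "s < r" for r
  proof -
    have "r > 0" using that assms by simp
    then obtain d where "(V has_real_derivative d) (at r)"
      "d \<le> - (1 / (2 * kI)) * ((norm (x r))\<^sup>2 + (norm (z r))\<^sup>2)"
      using dV by blast
    moreover have "(1 / (2 * kI)) * ((norm (x r))\<^sup>2 + (norm (z r))\<^sup>2) \<ge> 0" using gains by simp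
    ultimately show ?thesis by auto
  qed
  show "continuous_on {s..t} V" using cont_V assms by (auto intro: continuous_on_subset)
qed

lemma potential_le_V: "kP * \<psi> t \<le> V t"
  unfolding V_def using gains by (auto intro!: add_nonneg_nonneg)

text \<open>The initial conditions give \<open>z 0 = 0\<close>, so \<open>V\<close> starts at
  \<open>kP * \<psi> 0\<close>, and afterwards it decreases while dominating
  \<open>kP * \<psi> t\<close>.\<close>

lemma potential_le_initial:
  assumes "x 0 = 0" "kI *\<^sub>R u 0 + \<beta> 0 = 0" "t \<ge> 0"
  shows "\<psi> t \<le> \<psi> 0"
proof -
  have "kP * \<psi> t \<le> V t" by (rule potential_le_V)
  also have "\<dots> \<le> V 0" using V_decreasing assms(3) by simp
  also have "V 0 = kP * \<psi> 0" using assms by (simp add: V_def z_def)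
  finally show ?thesis using gains by simp
qed

text \<open>As the potential is bounded below, the initial value of \<open>V\<close> leaves the
  fixed budget \<open>Q\<close> for the two quadratic terms.\<close>

lemma bounded_x_z: "\<exists>R. \<forall>t\<ge>0. norm (x t) \<le> R \<and> norm (z t) \<le> R"
proof -
  define Q where "Q = V 0 - kP * m"
  have "norm (x t) \<le> max 1 (2 * Q) \<and> norm (z t) \<le> max 1 (2 * kI\<^sup>2 * Q)" if "t \<ge> 0" for t
  proof -
    have pm: "kP * m \<le> kP * \<psi> t" using \<psi>_bound[OF that] gains by simp
    have "(norm (x t))\<^sup>2 / 2 + (norm (z t))\<^sup>2 / (2 * kI\<^sup>2) \<le> Q"
      using V_decreasing[of 0 t] that pm
      unfolding Q_def V_def[of t] by (simp add: power2_norm_eq_inner)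
    moreover have "(norm (z t))\<^sup>2 / (2 * kI\<^sup>2) \<ge> 0" "(norm (x t))\<^sup>2 / 2 \<ge> 0" using gains by auto
    ultimately have *: "(norm (x t))\<^sup>2 \<le> 2 * Q" "(norm (z t))\<^sup>2 / (2 * kI\<^sup>2) \<le> Q" by linarith+
    have "(norm (z t))\<^sup>2 \<le> 2 * kI\<^sup>2 * Q" using *(2) gains by (simp add: field_simps)
    \<comment> \<open>This passes from squares to norms without square roots:
      \<open>a \<le> a\<^sup>2\<close> as soon as \<open>a > 1\<close>.\<close>
    moreover have "a \<le> max 1 q" if "a\<^sup>2 \<le> q" for a q :: real
    proof (cases "a \<le> 1")
      case False
      then have "a \<le> a\<^sup>2" by (simp add: power2_eq_square)
      then show ?thesis using that by simp
    qed auto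
    ultimately show ?thesis using * by blast
  qed
  then show ?thesis
    by (intro exI[of _ "max (max 1 (2 * Q)) (max 1 (2 * kI\<^sup>2 * Q))"]) (meson le_max_iff_disj)
qed

text \<open>Provides one constant for the Lipschitz estimates in both applications of Barbalat's
  lemma; each derivative is controlled by signals already known to be bounded.\<close>

lemma bounded_derivatives:
  "\<exists>M. \<forall>t>0. norm ((b - kD + kI) *\<^sub>R x t - kP *\<^sub>R h t + z t) \<le> M \<and>
    (\<exists>d. (z has_vector_derivative d) (at t) \<and> norm d \<le> M) \<and>
    (\<exists>d. (h has_vector_derivative d) (at t) \<and> norm d \<le> M)"
proof -
  obtain R where R: "\<And>t. t \<ge> 0 \<Longrightarrow> norm (x t) \<le> R" "\<And>t. t \<ge> 0 \<Longrightarrow> norm (z t) \<le> R"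
    using bounded_x_z by blast
  have "R \<ge> 0" using R(1)[of 0] norm_ge_zero[of "x 0"] by linarith
  define M1 where "M1 = \<bar>b - kD + kI\<bar> * R + kP * L + R"
  define M2 where "M2 = kI * R + kI\<^sup>2 * R + B * R + kI * \<bar>b\<bar> * R"
  have "norm ((b - kD + kI) *\<^sub>R x t - kP *\<^sub>R h t + z t) \<le> M1 \<and>
    (\<exists>d. (z has_vector_derivative d) (at t) \<and> norm d \<le> M2) \<and>
    (\<exists>d. (h has_vector_derivative d) (at t) \<and> norm d \<le> H * R)" if t: "t > 0" for t
  proof (intro conjI)
    have "norm ((b - kD + kI) *\<^sub>R x t) \<le> \<bar>b - kD + kI\<bar> * R" "norm (kP *\<^sub>R h t) \<le> kP * L"
      using R[of t] h_bound[of t] t gains by (auto intro: mult_left_mono)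
    then show "norm ((b - kD + kI) *\<^sub>R x t - kP *\<^sub>R h t + z t) \<le> M1"
      unfolding M1_def using R(2)[of t] t
      by (intro order_trans[OF norm_triangle_ineq] add_mono order_trans[OF norm_triangle_ineq4]) auto
    obtain d where d: "(z has_vector_derivative - kI *\<^sub>R z t - kI\<^sup>2 *\<^sub>R x t + (d - (kI * b) *\<^sub>R x t)) (at t)"
      "norm d \<le> B * norm (x t)" using dz[OF t] by blast
    have "B * norm (x t) \<le> B * R" using R[of t] t gains by (auto intro: mult_left_mono)
    then have "norm d \<le> B * R" using d by simp
    moreover have "norm (- kI *\<^sub>R z t) \<le> kI * R" "norm (kI\<^sup>2 *\<^sub>R x t) \<le> kI\<^sup>2 * R"
       "norm ((kI * b) *\<^sub>R x t) \<le> kI * \<bar>b\<bar> * R"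
      using R[of t] t gains by (auto simp: abs_mult intro!: mult_left_mono)
    moreover have "norm (p - q + (r - s)) \<le> norm p + norm q + norm r + norm s" for p q r s :: 'a
      using norm_triangle_ineq[of "p - q" "r - s"] norm_triangle_ineq4[of p q] norm_triangle_ineq4[of r s]
      by linarith
    ultimately have "norm (- kI *\<^sub>R z t - kI\<^sup>2 *\<^sub>R x t + (d - (kI * b) *\<^sub>R x t)) \<le> M2"
      unfolding M2_def by (smt (verit, best))
    then show "\<exists>d. (z has_vector_derivative d) (at t) \<and> norm d \<le> M2" using d by blast
    show "\<exists>d. (h has_vector_derivative d) (at t) \<and> norm d \<le> H * R"
      using dh[OF t] R[of t] t gains by (meson less_imp_le mult_left_mono order_trans)
  qed
  then show ?thesis
    by (intro exI[of _ "max M1 (max M2 (H * R))"]) (meson le_max_iff_disj)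
qed

text \<open>\<open>V\<close> dissipates a multiple of the sum of the squared norms, and this sum is
  Lipschitz because the signals and their derivatives are bounded.\<close>

lemma x_z_tendsto_0: "(x \<longlongrightarrow> 0) at_top" "(z \<longlongrightarrow> 0) at_top"
proof -
  obtain R where R: "\<And>t. t \<ge> 0 \<Longrightarrow> norm (x t) \<le> R" "\<And>t. t \<ge> 0 \<Longrightarrow> norm (z t) \<le> R"
    using bounded_x_z by blast
  obtain M where M: "\<And>t. t > 0 \<Longrightarrow> norm ((b - kD + kI) *\<^sub>R x t - kP *\<^sub>R h t + z t) \<le> M"
    "\<And>t. t > 0 \<Longrightarrow> \<exists>d. (z has_vector_derivative d) (at t) \<and> norm d \<le> M"
    using bounded_derivatives by blast
  have sq: "\<bar>(norm (f t))\<^sup>2 - (norm (f s))\<^sup>2\<bar> \<le> 2 * R * M * (t - s)"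
    if "continuous_on {0..} f" "\<And>t. t > 0 \<Longrightarrow> \<exists>d. (f has_vector_derivative d) (at t) \<and> norm d \<le> M"
      "\<And>t. t \<ge> 0 \<Longrightarrow> norm (f t) \<le> R" "0 \<le> s" "s \<le> t" for f :: "real \<Rightarrow> 'a" and s t
  proof -
    have l: "norm (f t - f s) \<le> M * (t - s)"
      using bounded_derivative_lipschitz that by blast
    have "\<bar>(norm (f t))\<^sup>2 - (norm (f s))\<^sup>2\<bar> = \<bar>norm (f t) - norm (f s)\<bar> * (norm (f t) + norm (f s))"
      by (simp add: power2_eq_square square_diff_square_factored abs_mult)
    also have "\<dots> \<le> (M * (t - s)) * (2 * R)"
      using l norm_triangle_ineq3[of "f t" "f s"] that(3)[of t] that(3)[of s] that(4,5)
      by (intro mult_mono) auto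
    finally show ?thesis by (simp add: algebra_simps)
  qed
  have *: "((\<lambda>t. (norm (x t))\<^sup>2 + (norm (z t))\<^sup>2) \<longlongrightarrow> 0) at_top"
  proof (rule dissipation_tendsto_0[OF cont_V dV])
    show "kP * m \<le> V t" if "t \<ge> 0" for t
      using potential_le_V[of t] \<psi>_bound[OF that] gains by (smt (verit) mult_left_mono)
    show "\<bar>(norm (x t))\<^sup>2 + (norm (z t))\<^sup>2 - ((norm (x s))\<^sup>2 + (norm (z s))\<^sup>2)\<bar> \<le> (4 * R * M) * (t - s)"
      if "0 \<le> s" "s \<le> t" for s t
      using sq[OF cont(1) _ R(1) that] sq[OF cont_z M(2) R(2) that] dx' M(1)
      by (smt (verit, best) distrib_right)
  qed (use gains in auto)
  have "((\<lambda>t. norm (x t)) \<longlongrightarrow> 0) at_top \<and> ((\<lambda>t. norm (z t)) \<longlongrightarrow> 0) at_top"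
  proof -
    have "((\<lambda>t. (norm (x t))\<^sup>2) \<longlongrightarrow> 0) at_top"
      by (rule tendsto_sandwich[OF _ _ tendsto_const *]) auto
    moreover have "((\<lambda>t. (norm (z t))\<^sup>2) \<longlongrightarrow> 0) at_top"
      by (rule tendsto_sandwich[OF _ _ tendsto_const *]) auto
    ultimately show ?thesis
      by (auto dest: tendsto_real_sqrt)
  qed
  then show "(x \<longlongrightarrow> 0) at_top" "(z \<longlongrightarrow> 0) at_top"
    by (auto intro: tendsto_norm_zero_cancel)
qed

text \<open>The velocity tends to 0 and its derivative is Lipschitz, so the derivative tends to 0
  too; all its terms but the gradient are already known to vanish.\<close>

lemma gradient_tendsto_0: "(h \<longlongrightarrow> 0) at_top"
proof -
  obtain M where M: "\<And>t. t > 0 \<Longrightarrow> norm ((b - kD + kI) *\<^sub>R x t - kP *\<^sub>R h t + z t) \<le> M"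
    "\<And>t. t > 0 \<Longrightarrow> \<exists>d. (z has_vector_derivative d) (at t) \<and> norm d \<le> M"
    "\<And>t. t > 0 \<Longrightarrow> \<exists>d. (h has_vector_derivative d) (at t) \<and> norm d \<le> M"
    using bounded_derivatives by blast
  let ?y = "\<lambda>t. (b - kD + kI) *\<^sub>R x t - kP *\<^sub>R h t + z t"
  let ?C = "\<bar>b - kD + kI\<bar> * M + kP * M + M"
  have "(?y \<longlongrightarrow> 0) at_top"
  proof (rule derivative_tendsto_0[OF cont(1) dx' _ x_z_tendsto_0(1)])
    show "norm (?y t - ?y s) \<le> ?C * (t - s)" if st: "0 \<le> s" "s \<le> t" for s t
    proof -
      have 1: "norm (x t - x s) \<le> M * (t - s)"
        using bounded_derivative_lipschitz[OF cont(1) _ st] dx' M(1) by blast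
      have 2: "norm (h t - h s) \<le> M * (t - s)"
        using bounded_derivative_lipschitz[OF cont(3) M(3) st] .
      have 3: "norm (z t - z s) \<le> M * (t - s)"
        using bounded_derivative_lipschitz[OF cont_z M(2) st] .
      have "norm ((b - kD + kI) *\<^sub>R (x t - x s)) \<le> \<bar>b - kD + kI\<bar> * (M * (t - s))"
        "norm (kP *\<^sub>R (h t - h s)) \<le> kP * (M * (t - s))"
        using 1 2 gains by (auto intro: mult_left_mono)
      moreover have "?y t - ?y s = (b - kD + kI) *\<^sub>R (x t - x s) - kP *\<^sub>R (h t - h s) + (z t - z s)"
        by (simp add: algebra_simps)
      moreover have "norm (p - q + r) \<le> norm p + norm q + norm r" for p q r :: 'a
        using norm_triangle_ineq[of "p - q" r] norm_triangle_ineq4[of p q] by linarith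
      ultimately have "norm (?y t - ?y s) \<le> \<bar>b - kD + kI\<bar> * (M * (t - s)) + kP * (M * (t - s)) + M * (t - s)"
        using 3 by (smt (verit, best))
      then show ?thesis by (simp add: algebra_simps)
    qed
  qed
  \<comment> \<open>The equation for the derivative of \<open>x\<close>, solved for
    \<open>h\<close>.\<close>
  then have "((\<lambda>t. (1 / kP) *\<^sub>R ((b - kD + kI) *\<^sub>R x t + z t - ?y t)) \<longlongrightarrow>
      (1 / kP) *\<^sub>R ((b - kD + kI) *\<^sub>R 0 + 0 - 0)) at_top"
    by (intro tendsto_intros x_z_tendsto_0)
  then show ?thesis using gains by simp
qed

lemma residual_tendsto_0: "((\<lambda>t. kI *\<^sub>R u t + \<beta> t) \<longlongrightarrow> 0) at_top"
proof -
  have "((\<lambda>t. z t + kI *\<^sub>R x t) \<longlongrightarrow> 0 + kI *\<^sub>R 0) at_top"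
    by (intro tendsto_intros x_z_tendsto_0)
  then show ?thesis by (simp add: z_def)
qed

end


section \<open>Left derivatives on a Lie group\<close>

lemma smooth_on_has_derivative:
  assumes "smooth_on S f" "x \<in> S"
  shows "(f has_derivative frechet_derivative f (at x)) (at x)"
proof -
  have "Ck_on (Suc 0) S f" using assms by (auto simp: smooth_on_def)
  then show ?thesis using assms(2) frechet_derivative_works by auto
qed

lemma smooth_on_derivative:
  assumes "smooth_on S f"
  shows "smooth_on S (\<lambda>x. frechet_derivative f (at x) v)"
  unfolding smooth_on_def
proof (intro conjI allI)
  show "open S" using assms by (simp add: smooth_on_def)
  fix k
  have "Ck_on (Suc k) S f" using assms unfolding smooth_on_def by blast
  then show "Ck_on k S (\<lambda>x. frechet_derivative f (at x) v)" by simp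
qed

lemma smooth_on_imp_continuous_on: "smooth_on S f \<Longrightarrow> continuous_on S f"
  by (metis Ck_on.simps(1) smooth_on_def)

lemma has_left_derivativeD:
  "has_left_derivative G X \<kappa> f D p \<Longrightarrow> \<gamma> t = p \<Longrightarrow> has_left_velocity G X \<kappa> \<gamma> \<xi> t UNIV \<Longrightarrow>
    ((\<lambda>s. f (\<gamma> s)) has_vector_derivative D \<xi>) (at t)"
  by (simp add: has_left_derivative_def)

locale charted_lie_group = lie_group G X A
  for G :: "('g, 'm) monoid_scheme" (structure) and X :: "'g topology"
    and A :: "('g, 'a::euclidean_space) chart set" +
  fixes U :: "'g set" and \<kappa> :: "'g \<Rightarrow> 'a"
  assumes chart_at_one: "(U, \<kappa>) \<in> A" and one_in_U: "\<one> \<in> U"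
begin

context
  fixes V c assumes chart: "(V, c) \<in> A"
begin

lemma openin_chart: "openin X V"
  and open_chart_image: "open (c ` V)"
  and homeomorphic_chart: "homeomorphic_map (subtopology X V) (top_of_set (c ` V)) c"
  using atlas chart by (auto simp: smooth_atlas_def is_chart_def)

lemma chart_subset: "V \<subseteq> carrier G"
  using openin_subset[OF openin_chart] topspace_eq by simp

lemma inj_on_chart: "inj_on c V"
  using homeomorphic_imp_injective_map[OF homeomorphic_chart] chart_subset topspace_eq
  by (simp add: topspace_subtopology Int_absorb1)

lemma open_chart_image_subset:
  assumes "openin X W" "W \<subseteq> V"
  shows "open (c ` W)"
proof -
  have "openin (subtopology X V) W"
    using assms openin_chart by (simp add: openin_open_subtopology)
  then have "openin (top_of_set (c ` V)) (c ` W)"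
    using homeomorphic_imp_open_map[OF homeomorphic_chart] by (simp add: open_map_def)
  then show ?thesis using open_chart_image openin_open_eq by blast
qed

lemma openin_chart_vimage:
  assumes "open O'"
  shows "openin X {q \<in> V. c q \<in> O'}"
proof -
  have "continuous_map (subtopology X V) euclidean c"
    using homeomorphic_imp_continuous_map[OF homeomorphic_chart]
    by (simp add: continuous_map_in_subtopology)
  then have "openin (subtopology X V) {q \<in> topspace (subtopology X V). c q \<in> O'}"
    using assms by (intro openin_continuous_map_preimage) auto
  moreover have tp: "topspace (subtopology X V) = V"
    using chart_subset topspace_eq by (auto simp: topspace_subtopology)
  ultimately have "openin (subtopology X V) {q \<in> V. c q \<in> O'}" by (simp only: tp)
  then show ?thesis using openin_chart by (simp add: openin_open_subtopology)
qed

end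

section \<open>Left translations, velocities of curves and uniqueness of left derivatives\<close>

lemma continuous_mult: "continuous_map (prod_topology X X) X (\<lambda>(x, y). x \<otimes> y)"
  using smooth_mult by (simp add: smooth_map_def)

lemma continuous_left_translation:
  assumes "p \<in> carrier G"
  shows "continuous_map X X (\<lambda>x. p \<otimes> x)"
proof -
  have "continuous_map X (prod_topology X X) (\<lambda>x. (p, x))"
    using assms topspace_eq by (intro continuous_map_pairedI) auto
  from continuous_map_compose[OF this continuous_mult] show ?thesis by (simp add: o_def)
qed

lemma one_in_chart_nbhd:
  assumes "p \<in> carrier G" "openin X W" "p \<in> W"
  shows "openin X {x \<in> U. p \<otimes> x \<in> W}" "\<one> \<in> {x \<in> U. p \<otimes> x \<in> W}"
proof -
  have "openin X {x \<in> topspace X. p \<otimes> x \<in> W}"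
    using continuous_left_translation[OF assms(1)] assms(2) by (rule openin_continuous_map_preimage)
  then have "openin X (U \<inter> {x \<in> topspace X. p \<otimes> x \<in> W})"
    using openin_chart[OF chart_at_one] by blast
  moreover have "U \<inter> {x \<in> topspace X. p \<otimes> x \<in> W} = {x \<in> U. p \<otimes> x \<in> W}"
    using chart_subset[OF chart_at_one] topspace_eq by auto
  ultimately show "openin X {x \<in> U. p \<otimes> x \<in> W}" by simp
  show "\<one> \<in> {x \<in> U. p \<otimes> x \<in> W}" using one_in_U assms by simp
qed

text \<open>Convergence of the curve follows from that of its coordinates: \<open>\<kappa>\<close>
  maps small neighbourhoods of the identity to open sets and is injective on \<open>U\<close>, where
  the translated curve lies near time 0.\<close>

lemma left_velocityI:
  assumes p: "p \<in> carrier G" "\<gamma> 0 = p"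
    and ev: "\<forall>\<^sub>F s in at 0. \<gamma> s \<in> carrier G \<and> inv p \<otimes> \<gamma> s \<in> U"
    and deriv: "((\<lambda>s. \<kappa> (inv p \<otimes> \<gamma> s)) has_vector_derivative \<xi>) (at 0)"
  shows "has_left_velocity G X \<kappa> \<gamma> \<xi> 0 UNIV"
  unfolding has_left_velocity_def
proof (intro conjI)
  show "((\<lambda>s. \<kappa> (inv \<gamma> 0 \<otimes> \<gamma> s)) has_vector_derivative \<xi>) (at 0)" using deriv p by simp
  show "limitin X \<gamma> (\<gamma> 0) (at 0)"
    unfolding limitin_def
  proof (intro conjI allI impI)
    show "\<gamma> 0 \<in> topspace X" using p topspace_eq by simp
    fix W assume W: "openin X W \<and> \<gamma> 0 \<in> W"
    let ?N = "{x \<in> U. p \<otimes> x \<in> W}"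
    have N: "openin X ?N" "\<one> \<in> ?N" using one_in_chart_nbhd[of p W] W p by auto
    have op: "open (\<kappa> ` ?N)" using open_chart_image_subset[OF chart_at_one N(1)] by blast
    have "\<kappa> (inv p \<otimes> \<gamma> 0) = \<kappa> \<one>" using p by simp
    then have "((\<lambda>s. \<kappa> (inv p \<otimes> \<gamma> s)) \<longlongrightarrow> \<kappa> \<one>) (at 0)"
      using has_vector_derivative_continuous[OF deriv] by (simp add: continuous_within)
    then have "\<forall>\<^sub>F s in at 0. \<kappa> (inv p \<otimes> \<gamma> s) \<in> \<kappa> ` ?N"
      using op N(2) by (intro topological_tendstoD) auto
    with ev show "\<forall>\<^sub>F s in at 0. \<gamma> s \<in> W"
    proof eventually_elim
      case (elim s)
      then obtain x where x: "x \<in> U" "p \<otimes> x \<in> W" "\<kappa> (inv p \<otimes> \<gamma> s) = \<kappa> x" by auto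
      then have "inv p \<otimes> \<gamma> s = x"
        using inj_on_chart[OF chart_at_one] elim by (meson inj_onD)
      then have "p \<otimes> x = \<gamma> s" using elim p by (auto simp: m_assoc[symmetric])
      then show ?case using x by simp
    qed
  qed
qed

lemma has_left_velocity_line:
  assumes "p \<in> carrier G"
  shows "has_left_velocity G X \<kappa> (\<lambda>s. p \<otimes> inv_into U \<kappa> (\<kappa> \<one> + s *\<^sub>R \<xi>)) \<xi> 0 UNIV"
proof (rule left_velocityI[OF assms])
  have inv1: "inv_into U \<kappa> (\<kappa> \<one>) = \<one>"
    using inj_on_chart[OF chart_at_one] one_in_U by simp
  then show "p \<otimes> inv_into U \<kappa> (\<kappa> \<one> + 0 *\<^sub>R \<xi>) = p" using assms by simp
  have "((\<lambda>s. \<kappa> \<one> + s *\<^sub>R \<xi>) \<longlongrightarrow> \<kappa> \<one> + 0 *\<^sub>R \<xi>) (at 0)" by (intro tendsto_intros)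
  then have ev: "\<forall>\<^sub>F s in at 0. \<kappa> \<one> + s *\<^sub>R \<xi> \<in> \<kappa> ` U"
    using open_chart_image[OF chart_at_one] one_in_U by (intro topological_tendstoD) auto
  have e: "inv_into U \<kappa> y \<in> U \<and> inv p \<otimes> (p \<otimes> inv_into U \<kappa> y) = inv_into U \<kappa> y \<and>
      \<kappa> (inv_into U \<kappa> y) = y" if "y \<in> \<kappa> ` U" for y
    using that inv_into_into[OF that] chart_subset[OF chart_at_one] assms
    by (auto simp: m_assoc[symmetric] f_inv_into_f)
  show "\<forall>\<^sub>F s in at 0. p \<otimes> inv_into U \<kappa> (\<kappa> \<one> + s *\<^sub>R \<xi>) \<in> carrier G \<and>
      inv p \<otimes> (p \<otimes> inv_into U \<kappa> (\<kappa> \<one> + s *\<^sub>R \<xi>)) \<in> U"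
    using ev e chart_subset[OF chart_at_one] assms by (auto elim!: eventually_mono)
  have "((\<lambda>s. \<kappa> \<one> + s *\<^sub>R \<xi>) has_vector_derivative \<xi>) (at 0)"
    by (auto intro!: derivative_eq_intros)
  then show "((\<lambda>s. \<kappa> (inv p \<otimes> (p \<otimes> inv_into U \<kappa> (\<kappa> \<one> + s *\<^sub>R \<xi>)))) has_vector_derivative \<xi>) (at 0)"
    unfolding has_vector_derivative_def
  proof (rule has_derivative_transform_eventually)
    show "\<forall>\<^sub>F s in at 0. \<kappa> \<one> + s *\<^sub>R \<xi> = \<kappa> (inv p \<otimes> (p \<otimes> inv_into U \<kappa> (\<kappa> \<one> + s *\<^sub>R \<xi>)))"
      using ev e by (auto elim!: eventually_mono)
    show "\<kappa> \<one> + 0 *\<^sub>R \<xi> = \<kappa> (inv p \<otimes> (p \<otimes> inv_into U \<kappa> (\<kappa> \<one> + 0 *\<^sub>R \<xi>)))"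
      using e[of "\<kappa> \<one>"] one_in_U by simp
  qed auto
qed

text \<open>Both derivatives are read off along the coordinate line of velocity
  \<open>\<xi>\<close>. This makes the description in \<open>left_grad\<close> well defined.\<close>

lemma has_left_derivative_unique:
  assumes "p \<in> carrier G" "has_left_derivative G X \<kappa> f D p" "has_left_derivative G X \<kappa> f D' p"
  shows "D = D'"
proof
  fix \<xi>
  let ?\<gamma> = "\<lambda>s. p \<otimes> inv_into U \<kappa> (\<kappa> \<one> + s *\<^sub>R \<xi>)"
  have "?\<gamma> 0 = p" using inj_on_chart[OF chart_at_one] one_in_U assms by simp
  then have "((\<lambda>s. f (?\<gamma> s)) has_vector_derivative D \<xi>) (at 0)"
    "((\<lambda>s. f (?\<gamma> s)) has_vector_derivative D' \<xi>) (at 0)"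
    using has_left_derivativeD[OF assms(2) _ has_left_velocity_line[OF assms(1)]]
      has_left_derivativeD[OF assms(3) _ has_left_velocity_line[OF assms(1)]] by blast+
  then show "D \<xi> = D' \<xi>" by (rule vector_derivative_unique_at)
qed

lemma left_grad_eqI:
  assumes "p \<in> carrier G" "has_left_derivative G X \<kappa> f (\<lambda>\<xi>. v \<bullet> \<xi>) p"
  shows "left_grad G X \<kappa> f p = v"
  unfolding left_grad_def
proof (rule the_equality)
  show "has_left_derivative G X \<kappa> f (\<lambda>\<xi>. v \<bullet> \<xi>) p" by (rule assms(2))
  fix w assume "has_left_derivative G X \<kappa> f (\<lambda>\<xi>. w \<bullet> \<xi>) p"
  from has_left_derivative_unique[OF assms(1) this assms(2)] show "w = v"
    by (intro vector_eq_rdot[THEN iffD1]) (auto dest: fun_cong)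
qed

text \<open>The curves admitted by \<open>has_left_derivative\<close> need not be continuous away from the base
  point. If \<open>f\<close> were discontinuous at \<open>p\<close>, points violating continuity could be threaded into a
  curve of velocity \<open>0\<close> through \<open>p\<close> along which \<open>f\<close> is not even continuous.\<close>

lemma has_left_derivative_imp_nbhd:
  fixes f :: "'g \<Rightarrow> 'b::real_normed_vector"
  assumes p: "p \<in> carrier G" and "has_left_derivative G X \<kappa> f D p" and "e > 0"
  shows "\<exists>W. openin X W \<and> p \<in> W \<and> (\<forall>q\<in>W. dist (f q) (f p) < e)"
proof (rule ccontr)
  assume neg: "\<not> ?thesis"
  \<comment> \<open>The radius is \<open>s\<^sup>2\<close> so that points chosen from
    \<open>N s\<close> approach \<open>p\<close> faster than linearly in \<open>s\<close>, which
    gives the curve velocity 0.\<close>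
  define N where "N s = {q \<in> carrier G. inv p \<otimes> q \<in> U \<and> \<kappa> (inv p \<otimes> q) \<in> ball (\<kappa> \<one>) (s\<^sup>2)}" for s :: real
  have "\<exists>q\<in>N s. \<not> dist (f q) (f p) < e" if "s \<noteq> 0" for s
  proof -
    have "openin X {q \<in> topspace X. inv p \<otimes> q \<in> {x \<in> U. \<kappa> x \<in> ball (\<kappa> \<one>) (s\<^sup>2)}}"
      using openin_continuous_map_preimage[OF continuous_left_translation[of "inv p"]
          openin_chart_vimage[OF chart_at_one open_ball]] p by simp
    moreover have "{q \<in> topspace X. inv p \<otimes> q \<in> {x \<in> U. \<kappa> x \<in> ball (\<kappa> \<one>) (s\<^sup>2)}} = N s"
      unfolding N_def topspace_eq by auto
    moreover have "p \<in> N s" unfolding N_def using p one_in_U that by simp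
    ultimately show ?thesis using neg by metis
  qed
  then obtain \<gamma>0 where \<gamma>0: "\<And>s. s \<noteq> 0 \<Longrightarrow> \<gamma>0 s \<in> N s \<and> \<not> dist (f (\<gamma>0 s)) (f p) < e"
    by metis
  define \<gamma> where "\<gamma> s = (if s = 0 then p else \<gamma>0 s)" for s
  have \<gamma>: "\<gamma> s \<in> N s \<and> \<not> dist (f (\<gamma> s)) (f p) < e" if "s \<noteq> 0" for s
    using \<gamma>0 that by (simp add: \<gamma>_def)
  have "has_left_velocity G X \<kappa> \<gamma> 0 0 UNIV"
  proof (rule left_velocityI[OF p])
    show "\<gamma> 0 = p" by (simp add: \<gamma>_def)
    show "\<forall>\<^sub>F s in at 0. \<gamma> s \<in> carrier G \<and> inv p \<otimes> \<gamma> s \<in> U"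
      using \<gamma> by (auto simp: eventually_at_filter N_def)
    have "((\<lambda>s. (1 / norm s) *\<^sub>R (\<kappa> (inv p \<otimes> \<gamma> s) - \<kappa> \<one>)) \<longlongrightarrow> 0) (at 0)"
    proof (rule Lim_null_comparison)
      show "\<forall>\<^sub>F s in at 0. norm ((1 / norm s) *\<^sub>R (\<kappa> (inv p \<otimes> \<gamma> s) - \<kappa> \<one>)) \<le> \<bar>s\<bar>"
        unfolding eventually_at_filter
      proof (rule eventuallyI, intro impI)
        fix s :: real assume "s \<noteq> 0"
        then have "norm (\<kappa> (inv p \<otimes> \<gamma> s) - \<kappa> \<one>) \<le> \<bar>s\<bar> * \<bar>s\<bar>"
          using \<gamma>[of s] by (simp add: N_def dist_norm norm_minus_commute power2_eq_square)
        then show "norm ((1 / norm s) *\<^sub>R (\<kappa> (inv p \<otimes> \<gamma> s) - \<kappa> \<one>)) \<le> \<bar>s\<bar>"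
          using \<open>s \<noteq> 0\<close> by (simp add: divide_le_eq)
      qed
      show "((\<lambda>s. \<bar>s\<bar>) \<longlongrightarrow> 0) (at (0::real))"
        using tendsto_rabs[OF tendsto_ident_at, of 0 UNIV] by simp
    qed
    then show "((\<lambda>s. \<kappa> (inv p \<otimes> \<gamma> s)) has_vector_derivative 0) (at 0)"
      unfolding has_vector_derivative_def has_derivative_def
      using p by (simp add: \<gamma>_def[of 0] inverse_eq_divide)
  qed
  then have "((\<lambda>s. f (\<gamma> s)) has_vector_derivative D 0) (at 0)"
    using has_left_derivativeD[OF assms(2)] by (simp add: \<gamma>_def[of 0])
  then have "((\<lambda>s. f (\<gamma> s)) \<longlongrightarrow> f p) (at 0)"
    using has_vector_derivative_continuous by (fastforce simp: continuous_within \<gamma>_def)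
  then have "\<forall>\<^sub>F s in at 0. dist (f (\<gamma> s)) (f p) < e" using \<open>e > 0\<close> by (rule tendstoD)
  moreover have "\<forall>\<^sub>F s in at (0::real). s \<noteq> 0" by (simp add: eventually_at_filter)
  ultimately have "\<forall>\<^sub>F s in at (0::real). False"
    by eventually_elim (use \<gamma> in blast)
  then show False by simp
qed

text \<open>Supplies the continuity of the gradient and of the bias on the group.\<close>

lemma has_left_derivative_imp_continuous_map:
  fixes f :: "'g \<Rightarrow> 'b::real_normed_vector"
  assumes "\<And>p. p \<in> carrier G \<Longrightarrow> \<exists>D. has_left_derivative G X \<kappa> f D p"
  shows "continuous_map X euclidean f"
  unfolding continuous_map
proof (intro conjI allI impI)
  fix O' :: "'b set" assume "openin euclidean O'"
  then have O': "open O'" by simp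
  show "openin X {x \<in> topspace X. f x \<in> O'}"
  proof (subst openin_subopen, intro ballI)
    fix p assume p: "p \<in> {x \<in> topspace X. f x \<in> O'}"
    then obtain e where e: "e > 0" "\<And>y. dist y (f p) < e \<Longrightarrow> y \<in> O'"
      using O' unfolding open_dist by blast
    have pG: "p \<in> carrier G" using p topspace_eq by simp
    obtain W where "openin X W" "p \<in> W" "\<forall>q\<in>W. dist (f q) (f p) < e"
      using assms[OF pG] has_left_derivative_imp_nbhd[OF pG _ e(1)] by blast
    then show "\<exists>T. openin X T \<and> p \<in> T \<and> T \<subseteq> {x \<in> topspace X. f x \<in> O'}"
      using e(2) openin_subset by (intro exI[of _ W]) blast
  qed
qed auto

section \<open>Left derivatives in charts\<close>

definition chart_mult :: "'g set \<Rightarrow> ('g \<Rightarrow> 'a) \<Rightarrow> 'a \<times> 'a \<Rightarrow> 'a" where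
  "chart_mult V c = c \<circ> (\<lambda>(x, y). x \<otimes> y) \<circ> inv_into (V \<times> U) (map_prod c \<kappa>)"

definition chart_mult_dom :: "'g set \<Rightarrow> ('g \<Rightarrow> 'a) \<Rightarrow> ('a \<times> 'a) set" where
  "chart_mult_dom V c = map_prod c \<kappa> ` ((V \<times> U) \<inter> (\<lambda>(x, y). x \<otimes> y) -` V)"

text \<open>The differential at the identity of left translation by the point with coordinates
  \<open>x\<close>, read in the charts \<open>\<kappa>\<close> and \<open>c\<close>. It turns left
  velocities into coordinate velocities.\<close>

definition frame :: "'g set \<Rightarrow> ('g \<Rightarrow> 'a) \<Rightarrow> 'a \<Rightarrow> 'a \<Rightarrow> 'a" where
  "frame V c x \<xi> = frechet_derivative (chart_mult V c) (at (x, \<kappa> \<one>)) (0, \<xi>)"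

context
  fixes V c assumes chart: "(V, c) \<in> A"
begin

lemma smooth_chart_mult: "smooth_on (chart_mult_dom V c) (chart_mult V c)"
proof -
  have "(V \<times> U, map_prod c \<kappa>) \<in> prod_atlas A A"
    using chart chart_at_one unfolding prod_atlas_def by blast
  then show ?thesis
    using smooth_mult chart unfolding smooth_map_def chart_mult_def chart_mult_dom_def by fast
qed

lemma chart_mult_eq:
  assumes "x \<in> V" "y \<in> U"
  shows "chart_mult V c (c x, \<kappa> y) = c (x \<otimes> y)"
proof -
  have "inj_on (map_prod c \<kappa>) (V \<times> U)"
    using inj_on_chart[OF chart] inj_on_chart[OF chart_at_one] by (rule map_prod_inj_on)
  then have "inv_into (V \<times> U) (map_prod c \<kappa>) (map_prod c \<kappa> (x, y)) = (x, y)"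
    using assms by (intro inv_into_f_f) auto
  then show ?thesis by (simp add: chart_mult_def)
qed

lemma in_chart_mult_dom: "x \<in> c ` V \<Longrightarrow> (x, \<kappa> \<one>) \<in> chart_mult_dom V c"
  unfolding chart_mult_dom_def using one_in_U chart_subset[OF chart] by force

lemma frame_linear: "x \<in> c ` V \<Longrightarrow> bounded_linear (frame V c x)"
proof -
  assume "x \<in> c ` V"
  then have "bounded_linear (frechet_derivative (chart_mult V c) (at (x, \<kappa> \<one>)))"
    by (rule has_derivative_bounded_linear[OF smooth_on_has_derivative[OF smooth_chart_mult in_chart_mult_dom]])
  from bounded_linear_compose[OF this bounded_linear_Pair[OF bounded_linear_zero bounded_linear_ident]]
  show ?thesis unfolding frame_def[abs_def] .
qed

text \<open>Near \<open>t\<close> the curve is \<open>\<gamma> t\<close> times its own left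
  translate, so its coordinates are \<open>chart_mult\<close> with the first argument fixed and a
  second argument of derivative \<open>\<xi>\<close>.\<close>

lemma chart_has_vector_derivative:
  assumes "has_left_velocity G X \<kappa> \<gamma> \<xi> t UNIV" "\<gamma> t \<in> V"
  shows "((\<lambda>s. c (\<gamma> s)) has_vector_derivative frame V c (c (\<gamma> t)) \<xi>) (at t)"
proof -
  let ?p = "\<gamma> t" and ?e = "\<lambda>s. inv \<gamma> t \<otimes> \<gamma> s"
  have p: "?p \<in> carrier G" using assms(2) chart_subset[OF chart] by blast
  have lim: "limitin X \<gamma> ?p (at t)" and d: "((\<lambda>s. \<kappa> (?e s)) has_vector_derivative \<xi>) (at t)"
    using assms(1) unfolding has_left_velocity_def by auto
  have ev: "\<forall>\<^sub>F s in at t. \<gamma> s \<in> V"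
    using lim assms(2) openin_chart[OF chart] by (auto simp: limitin_def)
  have "limitin X ?e (inv ?p \<otimes> ?p) (at t)"
    using continuous_map_limit[OF continuous_left_translation[of "inv ?p"] lim] p by (simp add: o_def)
  then have "\<forall>\<^sub>F s in at t. ?e s \<in> U"
    using p one_in_U openin_chart[OF chart_at_one] by (auto simp: limitin_def)
  with ev have eq: "\<forall>\<^sub>F s in at t. chart_mult V c (c ?p, \<kappa> (?e s)) = c (\<gamma> s)"
  proof eventually_elim
    case (elim s)
    then have "?p \<otimes> ?e s = \<gamma> s" using p chart_subset[OF chart] by (auto simp: m_assoc[symmetric])
    then show ?case using chart_mult_eq[OF assms(2)] elim by simp
  qed
  have eq_t: "chart_mult V c (c ?p, \<kappa> (?e t)) = c ?p"
    using chart_mult_eq[OF assms(2) one_in_U] p by simp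
  have "((\<lambda>s. (c ?p, \<kappa> (?e s))) has_vector_derivative (0, \<xi>)) (at t)"
    by (intro has_vector_derivative_Pair d) auto
  moreover have "(chart_mult V c has_derivative frechet_derivative (chart_mult V c) (at (c ?p, \<kappa> \<one>)))
      (at (c ?p, \<kappa> (?e t)))"
    using smooth_on_has_derivative[OF smooth_chart_mult in_chart_mult_dom] assms(2) p by simp
  ultimately have "((\<lambda>s. chart_mult V c (c ?p, \<kappa> (?e s))) has_vector_derivative frame V c (c ?p) \<xi>) (at t)"
    unfolding frame_def
    by (auto intro: vector_derivative_diff_chain_within[unfolded o_def] has_derivative_at_withinI)
  then show ?thesis
    unfolding has_vector_derivative_def
    by (rule has_derivative_transform_eventually) (use eq eq_t in auto)
qed

lemma has_left_derivative_chart: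
  assumes "p \<in> V" and F: "(F has_derivative F') (at (c p))" and f: "\<And>q. q \<in> V \<Longrightarrow> f q = F (c q)"
  shows "has_left_derivative G X \<kappa> f (\<lambda>\<xi>. F' (frame V c (c p) \<xi>)) p"
  unfolding has_left_derivative_def
proof (intro conjI allI impI)
  show "bounded_linear (\<lambda>\<xi>. F' (frame V c (c p) \<xi>))"
    using bounded_linear_compose[OF has_derivative_bounded_linear[OF F] frame_linear] assms by blast
  fix \<gamma> t \<xi> assume *: "\<gamma> t = p \<and> has_left_velocity G X \<kappa> \<gamma> \<xi> t UNIV"
  then have "((\<lambda>s. c (\<gamma> s)) has_vector_derivative frame V c (c p) \<xi>) (at t)"
    using chart_has_vector_derivative assms(1) by blast
  then have "((\<lambda>s. F (c (\<gamma> s))) has_vector_derivative F' (frame V c (c p) \<xi>)) (at t)"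
    using F * by (auto intro: vector_derivative_diff_chain_within[unfolded o_def] has_derivative_at_withinI)
  then show "((\<lambda>s. f (\<gamma> s)) has_vector_derivative F' (frame V c (c p) \<xi>)) (at t)"
    unfolding has_vector_derivative_def
  proof (rule has_derivative_transform_eventually)
    have "\<forall>\<^sub>F s in at t. \<gamma> s \<in> V"
      using * assms(1) openin_chart[OF chart] unfolding has_left_velocity_def limitin_def by blast
    then show "\<forall>\<^sub>F s in at t. F (c (\<gamma> s)) = f (\<gamma> s)"
      by eventually_elim (simp add: f)
  qed (use * assms(1) f in auto)
qed

text \<open>A mixed second derivative of the multiplication: \<open>frame\<close> differentiates in
  the second argument, and is differentiated here in the first.\<close>

lemma frame_has_derivative:
  assumes "x \<in> c ` V"
  shows "((\<lambda>x. frame V c x i) has_derivative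
    (\<lambda>v. frechet_derivative (\<lambda>w. frechet_derivative (chart_mult V c) (at w) (0, i)) (at (x, \<kappa> \<one>)) (v, 0)))
    (at x)"
proof -
  let ?P = "\<lambda>w. frechet_derivative (chart_mult V c) (at w) (0, i)"
  have "((\<lambda>x. (x, \<kappa> \<one>)) has_derivative (\<lambda>v. (v, 0))) (at x)"
    by (auto intro!: derivative_eq_intros)
  moreover have "(?P has_derivative frechet_derivative ?P (at (x, \<kappa> \<one>))) (at (x, \<kappa> \<one>))"
    using smooth_on_has_derivative[OF smooth_on_derivative[OF smooth_chart_mult] in_chart_mult_dom[OF assms]] .
  ultimately show ?thesis
    unfolding frame_def using diff_chain_at[unfolded o_def] by fastforce
qed

lemma continuous_frame: "continuous_on (c ` V) (\<lambda>x. frame V c x i)"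
  using frame_has_derivative has_derivative_continuous
  by (intro continuous_at_imp_continuous_on) blast

lemma continuous_frame_derivative:
  "continuous_on (c ` V) (\<lambda>x.
    frechet_derivative (\<lambda>w. frechet_derivative (chart_mult V c) (at w) (0, i)) (at (x, \<kappa> \<one>)) v)"
proof -
  have "continuous_on (chart_mult_dom V c)
    (\<lambda>w. frechet_derivative (\<lambda>w. frechet_derivative (chart_mult V c) (at w) (0, i)) (at w) v)"
    by (intro smooth_on_imp_continuous_on smooth_on_derivative smooth_chart_mult)
  then show ?thesis
    by (rule continuous_on_compose2) (auto intro!: continuous_intros in_chart_mult_dom)
qed

text \<open>The operator norm is bounded by a continuous function \<open>N\<close> of the
  coordinates, which stays below \<open>N (c p) + 1\<close> near \<open>p\<close>.\<close>

lemma locally_bounded_left_derivative: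
  fixes F :: "'a \<Rightarrow> 'b::real_normed_vector"
  assumes "p \<in> V" and F: "\<And>x. x \<in> c ` V \<Longrightarrow> (F has_derivative F' x) (at x)"
    and cont: "\<And>v. continuous_on (c ` V) (\<lambda>x. F' x v)" and f: "\<And>q. q \<in> V \<Longrightarrow> f q = F (c q)"
  shows "\<exists>W K. openin X W \<and> p \<in> W \<and>
    (\<forall>q\<in>W. \<exists>D. has_left_derivative G X \<kappa> f D q \<and> onorm D \<le> K)"
proof -
  \<comment> \<open>Expanding \<open>frame V c x i\<close> in the basis leaves \<open>F' x\<close>
    evaluated at fixed vectors only, where \<open>cont\<close> gives continuity in
    \<open>x\<close>.\<close>
  define N where "N x = (\<Sum>i\<in>Basis. norm (\<Sum>j\<in>Basis. (frame V c x i \<bullet> j) *\<^sub>R F' x j))" for x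
  have "continuous_on (c ` V) N"
    unfolding N_def by (intro continuous_intros continuous_frame cont)
  then have "open (c ` V \<inter> N -` {..<N (c p) + 1})"
    using open_chart_image[OF chart] by (intro continuous_open_preimage) auto
  from openin_chart_vimage[OF chart this]
  have "openin X {q \<in> V. N (c q) < N (c p) + 1}" by (rule back_subst[where P = "openin X"]) auto
  moreover have "has_left_derivative G X \<kappa> f (\<lambda>\<xi>. F' (c q) (frame V c (c q) \<xi>)) q \<and>
      onorm (\<lambda>\<xi>. F' (c q) (frame V c (c q) \<xi>)) \<le> N (c q)" if "q \<in> V" for q
  proof
    show D: "has_left_derivative G X \<kappa> f (\<lambda>\<xi>. F' (c q) (frame V c (c q) \<xi>)) q"
      using has_left_derivative_chart[OF that F f] that by blast
    have lin: "bounded_linear (F' (c q))" using F that has_derivative_bounded_linear by blast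
    have "(\<Sum>j\<in>Basis. (w \<bullet> j) *\<^sub>R F' (c q) j) = F' (c q) w" for w
    proof -
      have "F' (c q) w = F' (c q) (\<Sum>j\<in>Basis. (w \<bullet> j) *\<^sub>R j)" by (simp add: euclidean_representation)
      also have "\<dots> = (\<Sum>j\<in>Basis. (w \<bullet> j) *\<^sub>R F' (c q) j)"
        using lin by (simp add: linear_sum linear_cmul bounded_linear.linear)
      finally show ?thesis by simp
    qed
    then have "N (c q) = (\<Sum>i\<in>Basis. norm (F' (c q) (frame V c (c q) i)))" by (simp add: N_def)
    moreover have "bounded_linear (\<lambda>\<xi>. F' (c q) (frame V c (c q) \<xi>))"
      using D by (simp add: has_left_derivative_def)
    ultimately show "onorm (\<lambda>\<xi>. F' (c q) (frame V c (c q) \<xi>)) \<le> N (c q)"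
      using onorm_componentwise by metis
  qed
  ultimately show ?thesis
    using assms(1)
    by (intro exI[of _ "{q \<in> V. N (c q) < N (c p) + 1}"] exI[of _ "N (c p) + 1"]) fastforce
qed

section \<open>The gradient of a smooth potential and its derivative\<close>

context
  fixes \<phi> assumes smooth: "smooth_potential X A \<phi>"
begin

lemma smooth_potential_chart: "smooth_on (c ` V) (\<phi> \<circ> inv_into V c)"
  using smooth chart unfolding smooth_potential_def smooth_map_def by (auto simp: o_def)

lemma potential_chart: "q \<in> V \<Longrightarrow> \<phi> q = (\<phi> \<circ> inv_into V c) (c q)"
  using inj_on_chart[OF chart] by simp

lemma has_left_derivative_potential_chart:
  assumes "q \<in> V"
  shows "has_left_derivative G X \<kappa> \<phi> (\<lambda>\<xi>. frechet_derivative (\<phi> \<circ> inv_into V c) (at (c q)) (frame V c (c q) \<xi>)) q"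
  using assms has_left_derivative_chart[OF assms smooth_on_has_derivative[OF smooth_potential_chart] potential_chart]
  by blast

text \<open>The left derivative is a linear functional, and its values on the orthonormal basis are
  the components of the vector representing it; by uniqueness that vector is the gradient.\<close>

lemma has_left_derivative_left_grad_chart:
  assumes "q \<in> V"
  shows "has_left_derivative G X \<kappa> \<phi> (\<lambda>\<xi>. left_grad G X \<kappa> \<phi> q \<bullet> \<xi>) q"
    and left_grad_chart: "left_grad G X \<kappa> \<phi> q =
      (\<Sum>i\<in>Basis. frechet_derivative (\<phi> \<circ> inv_into V c) (at (c q)) (frame V c (c q) i) *\<^sub>R i)"
proof -
  define D where "D = (\<lambda>\<xi>. frechet_derivative (\<phi> \<circ> inv_into V c) (at (c q)) (frame V c (c q) \<xi>))"
  have D: "has_left_derivative G X \<kappa> \<phi> D q"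
    unfolding D_def by (rule has_left_derivative_potential_chart[OF assms])
  then have lin: "linear D" by (simp add: has_left_derivative_def bounded_linear.linear)
  have "D = (\<lambda>\<xi>. (\<Sum>i\<in>Basis. D i *\<^sub>R i) \<bullet> \<xi>)"
  proof
    fix \<xi>
    have "D \<xi> = D (\<Sum>i\<in>Basis. (\<xi> \<bullet> i) *\<^sub>R i)" by (simp add: euclidean_representation)
    also have "\<dots> = (\<Sum>i\<in>Basis. (\<xi> \<bullet> i) * D i)" using lin by (simp add: linear_sum linear_cmul)
    also have "\<dots> = (\<Sum>i\<in>Basis. D i *\<^sub>R i) \<bullet> \<xi>"
      by (simp add: inner_sum_left inner_commute[of \<xi>] mult.commute)
    finally show "D \<xi> = (\<Sum>i\<in>Basis. D i *\<^sub>R i) \<bullet> \<xi>" .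
  qed
  then have D': "has_left_derivative G X \<kappa> \<phi> (\<lambda>\<xi>. (\<Sum>i\<in>Basis. D i *\<^sub>R i) \<bullet> \<xi>) q" using D by simp
  have q: "q \<in> carrier G" using assms chart_subset[OF chart] by blast
  show "left_grad G X \<kappa> \<phi> q =
      (\<Sum>i\<in>Basis. frechet_derivative (\<phi> \<circ> inv_into V c) (at (c q)) (frame V c (c q) i) *\<^sub>R i)"
    using left_grad_eqI[OF q D'] by (simp add: D_def)
  show "has_left_derivative G X \<kappa> \<phi> (\<lambda>\<xi>. left_grad G X \<kappa> \<phi> q \<bullet> \<xi>) q"
    using left_grad_eqI[OF q D'] D' by simp
qed

text \<open>In coordinates the gradient combines first derivatives of the potential and of the
  multiplication; by the product rule its derivative involves second derivatives, which are
  continuous.\<close>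

lemma left_grad_locally_bounded_left_derivative:
  assumes "p \<in> V"
  shows "\<exists>W K. openin X W \<and> p \<in> W \<and>
    (\<forall>q\<in>W. \<exists>D. has_left_derivative G X \<kappa> (left_grad G X \<kappa> \<phi>) D q \<and> onorm D \<le> K)"
proof -
  define d where "d = (\<lambda>j x. frechet_derivative (\<phi> \<circ> inv_into V c) (at x) j)"
  define d' where "d' = (\<lambda>j x. frechet_derivative (d j) (at x))"
  define a' where "a' = (\<lambda>i x v. frechet_derivative (\<lambda>w. frechet_derivative (chart_mult V c) (at w) (0, i)) (at (x, \<kappa> \<one>)) (v, 0))"
  \<comment> \<open>The derivative of the potential is written through its values
    \<open>d j x\<close> in fixed directions, so that \<open>F\<close> is a sum of products of
    differentiable functions.\<close>
  define F where "F = (\<lambda>x. \<Sum>i\<in>Basis. (\<Sum>j\<in>Basis. (frame V c x i \<bullet> j) * d j x) *\<^sub>R i)"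
  define F' where "F' = (\<lambda>x v. \<Sum>i\<in>Basis. (\<Sum>j\<in>Basis. (frame V c x i \<bullet> j) * d' j x v + (a' i x v \<bullet> j) * d j x) *\<^sub>R i)"
  have sd: "smooth_on (c ` V) (d j)" for j
    unfolding d_def by (intro smooth_on_derivative smooth_potential_chart)
  show ?thesis
  proof (rule locally_bounded_left_derivative[OF assms])
    show "(F has_derivative F' x) (at x)" if "x \<in> c ` V" for x
      unfolding F_def F'_def a'_def d'_def
      by (intro has_derivative_sum has_derivative_scaleR_left has_derivative_mult has_derivative_inner_left
          frame_has_derivative smooth_on_has_derivative[OF sd] that)
    show "continuous_on (c ` V) (\<lambda>x. F' x v)" for v
      unfolding F'_def a'_def d'_def
      by (intro continuous_intros continuous_frame continuous_frame_derivative
          smooth_on_imp_continuous_on[OF sd] smooth_on_imp_continuous_on[OF smooth_on_derivative[OF sd]])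
    show "left_grad G X \<kappa> \<phi> q = F (c q)" if "q \<in> V" for q
    proof -
      have lin: "linear (frechet_derivative (\<phi> \<circ> inv_into V c) (at (c q)))"
        using smooth_on_has_derivative[OF smooth_potential_chart] that
        by (auto dest: has_derivative_linear)
      have "frechet_derivative (\<phi> \<circ> inv_into V c) (at (c q)) w = (\<Sum>j\<in>Basis. (w \<bullet> j) * d j (c q))" for w
      proof -
        have "frechet_derivative (\<phi> \<circ> inv_into V c) (at (c q)) w
          = frechet_derivative (\<phi> \<circ> inv_into V c) (at (c q)) (\<Sum>j\<in>Basis. (w \<bullet> j) *\<^sub>R j)"
          by (simp add: euclidean_representation)
        also have "\<dots> = (\<Sum>j\<in>Basis. (w \<bullet> j) * d j (c q))"
          using lin by (simp add: linear_sum linear_cmul d_def)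
        finally show ?thesis .
      qed
      then show ?thesis unfolding left_grad_chart[OF that] F_def by simp
    qed
  qed
qed

end

end

context
  fixes \<phi> assumes smooth: "smooth_potential X A \<phi>"
begin

lemma chart_covers: "p \<in> carrier G \<Longrightarrow> \<exists>V c. (V, c) \<in> A \<and> p \<in> V"
proof -
  assume "p \<in> carrier G"
  moreover have "(\<Union>(V, c)\<in>A. V) = carrier G"
    using atlas unfolding smooth_atlas_def topspace_eq by simp
  ultimately have "p \<in> (\<Union>(V, c)\<in>A. V)" by simp
  then show ?thesis by auto
qed

lemma has_left_derivative_left_grad:
  "p \<in> carrier G \<Longrightarrow> has_left_derivative G X \<kappa> \<phi> (\<lambda>\<xi>. left_grad G X \<kappa> \<phi> p \<bullet> \<xi>) p"
  using chart_covers has_left_derivative_left_grad_chart(1)[OF _ smooth] by blast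

text \<open>A finite subcover by neighbourhoods with local bounds reduces the claim to a maximum of
  finitely many constants.\<close>

lemma left_grad_has_bounded_left_gradient:
  assumes compact: "compact_space X"
  shows "has_bounded_left_gradient G X \<kappa> (left_grad G X \<kappa> \<phi>)"
proof -
  define P where "P = (\<lambda>q K. \<exists>D. has_left_derivative G X \<kappa> (left_grad G X \<kappa> \<phi>) D q \<and> onorm D \<le> K)"
  define \<U> where "\<U> = {W. openin X W \<and> (\<exists>K. \<forall>q\<in>W. P q K)}"
  have "topspace X \<subseteq> \<Union>\<U>"
  proof
    fix p assume "p \<in> topspace X"
    then obtain V c where "(V, c) \<in> A" "p \<in> V" using chart_covers topspace_eq by blast
    from left_grad_locally_bounded_left_derivative[OF this(1) smooth this(2)]
    show "p \<in> \<Union>\<U>" unfolding \<U>_def P_def by blast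
  qed
  then obtain \<F> where \<F>: "finite \<F>" "\<F> \<subseteq> \<U>" "topspace X \<subseteq> \<Union>\<F>"
    using compact unfolding compact_space_alt \<U>_def by (metis (no_types, lifting) mem_Collect_eq)
  obtain K where K: "\<And>W q. W \<in> \<F> \<Longrightarrow> q \<in> W \<Longrightarrow> P q (K W)"
    using \<F>(2) unfolding \<U>_def subset_iff mem_Collect_eq by metis
  define B where "B = Max (insert 0 (K ` \<F>))"
  have "P p B" if "p \<in> carrier G" for p
  proof -
    have "p \<in> \<Union>\<F>" using that \<F>(3) unfolding topspace_eq by (rule subsetD[rotated])
    then obtain W where W: "W \<in> \<F>" "p \<in> W" by (rule UnionE)
    have "K W \<le> B" unfolding B_def using W \<F>(1) by (intro Max_ge) auto
    then show ?thesis using K[OF W] unfolding P_def by (meson order_trans)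
  qed
  then show ?thesis unfolding has_bounded_left_gradient_def P_def by metis
qed

end

end


section \<open>The closed loop\<close>

lemma closed_loop_solution_in_carrier:
  assumes "closed_loop_solution G X \<kappa> \<phi> b uB kP kI kD g \<xi> uI" "t \<ge> 0"
  shows "g t \<in> topspace X"
  using assms by (simp add: closed_loop_solution_def has_left_velocity_def limitin_def)

lemma closed_loop_solution_continuous_on:
  assumes sol: "closed_loop_solution G X \<kappa> \<phi> b uB kP kI kD g \<xi> uI"
    and f: "continuous_map X euclidean f"
  shows "continuous_on {0..} (\<lambda>t. f (g t))"
  unfolding continuous_on_def
proof
  fix t :: real assume "t \<in> {0..}"
  then have "limitin X g (g t) (at t within {0..})"
    using sol by (simp add: closed_loop_solution_def has_left_velocity_def)
  from continuous_map_limit[OF f this] show "((\<lambda>t. f (g t)) \<longlongrightarrow> f (g t)) (at t within {0..})"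
    by (simp add: o_def)
qed

locale pid_closed_loop = charted_lie_group G X A U \<kappa>
  for G :: "('g, 'm) monoid_scheme" (structure) and X :: "'g topology"
    and A :: "('g, 'a::euclidean_space) chart set" and U \<kappa> +
  fixes \<phi> :: "'g \<Rightarrow> real" and uB :: "'g \<Rightarrow> 'a" and b kP kI kD B :: real
  assumes compact: "compact_space X"
    and smooth: "smooth_potential X A \<phi>"
    and bias: "\<And>p. p \<in> carrier G \<Longrightarrow> \<exists>D. has_left_derivative G X \<kappa> uB D p \<and> onorm D \<le> B"
    and gains: "kP > 0" "kI \<ge> 1" "kD - kI \<ge> \<bar>b\<bar> + (B + \<bar>b\<bar>)\<^sup>2 + 1"
begin

abbreviation "grad \<equiv> left_grad G X \<kappa> \<phi>"
abbreviation "crit \<equiv> critical_points G X \<kappa> \<phi>"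
abbreviation "sol \<equiv> closed_loop_solution G X \<kappa> \<phi> b uB kP kI kD"
abbreviation "Sol \<equiv> closed_loop_trajectories G X \<kappa> \<phi> b uB kP kI kD"

lemma grad_bounded_gradient:
  obtains H where "H \<ge> 0"
    "\<And>p. p \<in> carrier G \<Longrightarrow> \<exists>D. has_left_derivative G X \<kappa> grad D p \<and> onorm D \<le> H"
proof -
  obtain D H where "\<And>p. p \<in> carrier G \<Longrightarrow> has_left_derivative G X \<kappa> grad (D p) p \<and> onorm (D p) \<le> H"
    using left_grad_has_bounded_left_gradient[OF smooth compact]
    unfolding has_bounded_left_gradient_def by blast
  then show ?thesis
    using that[of "max H 0"] by (meson max.cobounded2 max.coboundedI1)
qed

lemma B_nonneg: "B \<ge> 0"
proof -
  obtain D where "has_left_derivative G X \<kappa> uB D \<one>" "onorm D \<le> B" using bias[OF one_closed] by blast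
  then show ?thesis using onorm_pos_le[of D] by (simp add: has_left_derivative_def)
qed

lemma continuous_grad: "continuous_map X euclidean grad"
  using grad_bounded_gradient by (metis has_left_derivative_imp_continuous_map)

lemma continuous_bias: "continuous_map X euclidean uB"
  using bias by (metis has_left_derivative_imp_continuous_map)

lemma continuous_potential: "continuous_map X euclidean \<phi>"
  using smooth by (simp add: smooth_potential_def smooth_map_def)

lemma continuous_image_bounded:
  fixes f :: "'g \<Rightarrow> 'b::real_normed_vector"
  assumes "continuous_map X euclidean f"
  shows "\<exists>L. \<forall>p\<in>topspace X. norm (f p) \<le> L"
proof -
  have "compact (f ` topspace X)"
    using image_compactin[OF _ assms] compact by (simp add: compact_space_def)
  then show ?thesis by (auto dest!: compact_imp_bounded simp: bounded_iff)
qed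

text \<open>Transfers the signal analysis to trajectories on the group; compactness provides
  \<open>H\<close>, \<open>L\<close> and the lower bound of the potential.\<close>

lemma solution_pid_signals:
  assumes sol: "sol g \<xi> uI"
  obtains H L m where
    "pid_signals \<xi> uI (\<lambda>t. grad (g t)) (\<lambda>t. uB (g t)) (\<lambda>t. \<phi> (g t)) b kP kI kD B H L m"
proof -
  obtain H where H: "H \<ge> 0"
    "\<And>p. p \<in> carrier G \<Longrightarrow> \<exists>D. has_left_derivative G X \<kappa> grad D p \<and> onorm D \<le> H"
    using grad_bounded_gradient by blast
  obtain L where L: "\<And>p. p \<in> topspace X \<Longrightarrow> norm (grad p) \<le> L"
    using continuous_image_bounded[OF continuous_grad] by blast
  obtain M where M: "\<And>p. p \<in> topspace X \<Longrightarrow> norm (\<phi> p) \<le> M"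
    using continuous_image_bounded[OF continuous_potential] by blast
  have g: "g t \<in> topspace X" if "t \<ge> 0" for t
    using closed_loop_solution_in_carrier[OF sol that] .
  \<comment> \<open>At positive times the one-sided derivatives of a solution are two-sided, as
    \<open>has_left_derivative\<close> demands.\<close>
  have at: "at t within {0..} = at t" if "t > 0" for t :: real
    using that by (intro at_within_interior) simp
  have vel: "has_left_velocity G X \<kappa> g (\<xi> t) t UNIV" if "t > 0" for t
  proof -
    have "has_left_velocity G X \<kappa> g (\<xi> t) t {0..}" using sol that by (simp add: closed_loop_solution_def)
    then show ?thesis using at[OF that] by (simp add: has_left_velocity_def)
  qed
  have chain: "\<exists>d. ((\<lambda>t. f (g t)) has_vector_derivative d) (at t) \<and> norm d \<le> K * norm (\<xi> t)"
    if t: "t > 0" and f: "\<And>p. p \<in> carrier G \<Longrightarrow> \<exists>D. has_left_derivative G X \<kappa> f D p \<and> onorm D \<le> K"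
    for f :: "'g \<Rightarrow> 'a" and K t
  proof -
    have "g t \<in> carrier G" using t g[of t] topspace_eq by simp
    then obtain D where D: "has_left_derivative G X \<kappa> f D (g t)" "onorm D \<le> K"
      using f by blast
    have "((\<lambda>t. f (g t)) has_vector_derivative D (\<xi> t)) (at t)"
      using has_left_derivativeD[OF D(1) _ vel] t by simp
    moreover have "norm (D (\<xi> t)) \<le> onorm D * norm (\<xi> t)"
      using D(1) by (intro onorm) (simp add: has_left_derivative_def)
    moreover have "onorm D * norm (\<xi> t) \<le> K * norm (\<xi> t)"
      using D(2) by (intro mult_right_mono) auto
    ultimately show ?thesis by (meson order_trans)
  qed
  have "pid_signals \<xi> uI (\<lambda>t. grad (g t)) (\<lambda>t. uB (g t)) (\<lambda>t. \<phi> (g t)) b kP kI kD B H L (- M)"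
  proof
    show "continuous_on {0..} \<xi>" "continuous_on {0..} uI"
      using sol unfolding closed_loop_solution_def
      by (auto simp: continuous_on_eq_continuous_within intro: has_vector_derivative_continuous)
    show "continuous_on {0..} (\<lambda>t. grad (g t))" "continuous_on {0..} (\<lambda>t. uB (g t))"
      "continuous_on {0..} (\<lambda>t. \<phi> (g t))"
      using closed_loop_solution_continuous_on[OF sol] continuous_grad continuous_bias continuous_potential
      by blast+
    fix t :: real assume t: "t > 0"
    show "(\<xi> has_vector_derivative b *\<^sub>R \<xi> t + (- kP *\<^sub>R grad (g t) - kD *\<^sub>R \<xi> t + kI *\<^sub>R uI t) + uB (g t)) (at t)"
      and "(uI has_vector_derivative - kP *\<^sub>R grad (g t) - kD *\<^sub>R \<xi> t) (at t)"
      using sol[unfolded closed_loop_solution_def, rule_format, of t] t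
      by (simp_all add: at[OF t] pid_control_def)
    have "g t \<in> carrier G" using g[of t] t topspace_eq by simp
    from has_left_derivativeD[OF has_left_derivative_left_grad[OF smooth this] refl vel[OF t]]
    show "((\<lambda>t. \<phi> (g t)) has_real_derivative grad (g t) \<bullet> \<xi> t) (at t)"
      by (simp add: has_real_derivative_iff_has_vector_derivative)
    show "\<exists>d. ((\<lambda>t. uB (g t)) has_vector_derivative d) (at t) \<and> norm d \<le> B * norm (\<xi> t)"
      using chain[OF t bias] .
    show "\<exists>d. ((\<lambda>t. grad (g t)) has_vector_derivative d) (at t) \<and> norm d \<le> H * norm (\<xi> t)"
      using chain[OF t H(2)] .
  next
    fix t :: real assume "t \<ge> 0"
    then show "norm (grad (g t)) \<le> L" "- M \<le> \<phi> (g t)"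
      using L g M[of "g t"] by (auto simp: abs_le_iff)
  qed (use gains B_nonneg H(1) in auto)
  then show ?thesis using that by blast
qed

text \<open>On the compact complement of \<open>W\<close> the gradient takes values in a compact set
  that misses 0, so a gradient tending to 0 forces the trajectory into \<open>W\<close>.\<close>

lemma solution_tends_to_critical_points:
  assumes sol: "sol g \<xi> uI"
  shows "tends_to_set X g crit at_top"
  unfolding tends_to_set_def
proof (intro allI impI)
  fix W assume W: "openin X W \<and> crit \<subseteq> W"
  obtain H L m where
    "pid_signals \<xi> uI (\<lambda>t. grad (g t)) (\<lambda>t. uB (g t)) (\<lambda>t. \<phi> (g t)) b kP kI kD B H L m"
    using solution_pid_signals[OF sol] .
  then have lim: "((\<lambda>t. grad (g t)) \<longlongrightarrow> 0) at_top" by (rule pid_signals.gradient_tendsto_0)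
  have "compactin X (topspace X - W)"
    using W compact by (intro closedin_compact_space) auto
  then have "compact (grad ` (topspace X - W))"
    using image_compactin[OF _ continuous_grad] by simp
  then have "open (- grad ` (topspace X - W))" by (simp add: compact_imp_closed open_Compl)
  moreover have "0 \<in> - grad ` (topspace X - W)"
    using W topspace_eq by (force simp: critical_points_def)
  ultimately have "\<forall>\<^sub>F t in at_top. grad (g t) \<in> - grad ` (topspace X - W)"
    using lim by (intro topological_tendstoD)
  with eventually_ge_at_top[of 0] show "\<forall>\<^sub>F t in at_top. g t \<in> W"
    by eventually_elim (use closed_loop_solution_in_carrier[OF sol] in blast)
qed

lemma solution_converges:
  assumes "sol g \<xi> uI"
  shows "(\<xi> \<longlongrightarrow> 0) at_top" "((\<lambda>t. kI *\<^sub>R uI t + uB (g t)) \<longlongrightarrow> 0) at_top"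
  using solution_pid_signals[OF assms] pid_signals.x_z_tendsto_0(1) pid_signals.residual_tendsto_0
  by metis+

section \<open>Equilibria away from the minima\<close>

lemma solution_from_rest_below:
  assumes "sol g \<xi> uI" "\<xi> 0 = 0" "kI *\<^sub>R uI 0 = - uB (g 0)" "t \<ge> 0"
  shows "\<phi> (g t) \<le> \<phi> (g 0)"
proof -
  obtain H L m where
    "pid_signals \<xi> uI (\<lambda>t. grad (g t)) (\<lambda>t. uB (g t)) (\<lambda>t. \<phi> (g t)) b kP kI kD B H L m"
    using solution_pid_signals[OF assms(1)] .
  from pid_signals.potential_le_initial[OF this] show ?thesis using assms by simp
qed

text \<open>At a rest point with balanced bias the Lyapunov function reduces to the potential. So next to
  an equilibrium whose configuration is no local minimum there start trajectories that never
  return to the potential of the equilibrium.\<close>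

lemma escaping_trajectory:
  assumes eq: "(p, x, v) \<in> equilibria G X \<kappa> \<phi> uB kI" and nomin: "\<not> local_minimum X \<phi> p"
    and V: "openin (state_space X) V" "(p, x, v) \<in> V" "\<forall>z0\<in>V. \<exists>\<zeta>\<in>Sol. \<zeta> 0 = z0"
  obtains g \<xi> uI where "sol g \<xi> uI" "(g 0, \<xi> 0, uI 0) \<in> V" "\<phi> (g 0) < \<phi> p"
    "\<And>t. t \<ge> 0 \<Longrightarrow> \<phi> (g t) \<le> \<phi> (g 0)"
proof -
  have p: "p \<in> topspace X" "x = 0" "kI *\<^sub>R v = - uB p"
    using eq topspace_eq by (auto simp: equilibria_def critical_points_def)
  have kI: "kI > 0" using gains by simp
  \<comment> \<open>The state at rest over \<open>q\<close> whose integral term cancels the bias. It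
    depends continuously on \<open>q\<close> and is the given equilibrium at \<open>p\<close>, so
    points \<open>q\<close> near \<open>p\<close> of lower potential have their rest states in
    \<open>V\<close>.\<close>
  let ?s = "\<lambda>q. (q, 0::'a, (- 1 / kI) *\<^sub>R uB q)"
  have "v = (1 / kI) *\<^sub>R (kI *\<^sub>R v)" using kI by simp
  then have v: "?s p = (p, x, v)" using p by simp
  have "continuous_map X euclidean ((\<lambda>w. (- 1 / kI) *\<^sub>R w) \<circ> uB)"
    by (rule continuous_map_compose[OF continuous_bias]) (auto intro!: continuous_intros)
  then have "continuous_map X (state_space X) ?s"
    unfolding state_space_def by (intro continuous_map_pairedI) (auto simp: o_def)
  from openin_continuous_map_preimage[OF this V(1)]
  have "openin X {q \<in> topspace X. ?s q \<in> V}" .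
  moreover have "p \<in> {q \<in> topspace X. ?s q \<in> V}" using p V v by simp
  ultimately obtain q where q: "q \<in> topspace X" "?s q \<in> V" "\<phi> q < \<phi> p"
    using nomin unfolding local_minimum_def by (metis (no_types, lifting) mem_Collect_eq not_le)
  then obtain \<zeta> where "\<zeta> \<in> Sol" "\<zeta> 0 = ?s q" using V(3) by blast
  then obtain g \<xi> uI where s: "sol g \<xi> uI" "(g 0, \<xi> 0, uI 0) = ?s q"
    unfolding closed_loop_trajectories_def by auto
  then have "kI *\<^sub>R uI 0 = - uB (g 0)" using kI by simp
  then show ?thesis
    using that[OF s(1)] solution_from_rest_below[OF s(1)] s q by auto
qed

text \<open>Convergence to the equilibrium would bring the potential to \<open>\<phi> p\<close>, but
  on an escaping trajectory it stays below a smaller value.\<close>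

lemma asymptotically_stable_imp_local_minimum:
  assumes eq: "(p, x, v) \<in> equilibria G X \<kappa> \<phi> uB kI"
    and stable: "asymptotically_stable (state_space X) Sol (p, x, v)"
  shows "local_minimum X \<phi> p"
proof (rule ccontr)
  assume nomin: "\<not> local_minimum X \<phi> p"
  obtain V where V: "openin (state_space X) V" "(p, x, v) \<in> V"
    "\<And>\<zeta>. \<zeta> \<in> Sol \<Longrightarrow> \<zeta> 0 \<in> V \<Longrightarrow> limitin (state_space X) \<zeta> (p, x, v) at_top"
    using stable unfolding asymptotically_stable_def by blast
  have "lyapunov_stable (state_space X) Sol (p, x, v)"
    using stable by (simp add: asymptotically_stable_def)
  \<comment> \<open>Lyapunov stability enters through the existence of trajectories from all states
    near the equilibrium.\<close>
  then obtain V' where V': "openin (state_space X) V'" "(p, x, v) \<in> V'" "\<forall>z0\<in>V'. \<exists>\<zeta>\<in>Sol. \<zeta> 0 = z0"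
    using V(1,2) unfolding lyapunov_stable_def by meson
  obtain g \<xi> uI where s: "sol g \<xi> uI" "(g 0, \<xi> 0, uI 0) \<in> V \<inter> V'" "\<phi> (g 0) < \<phi> p"
    "\<And>t. t \<ge> 0 \<Longrightarrow> \<phi> (g t) \<le> \<phi> (g 0)"
    using escaping_trajectory[OF eq nomin, of "V \<inter> V'"] V V' by (metis IntE IntI openin_Int)
  have "(\<lambda>t. (g t, \<xi> t, uI t)) \<in> Sol" using s(1) unfolding closed_loop_trajectories_def by blast
  then have "limitin (state_space X) (\<lambda>t. (g t, \<xi> t, uI t)) (p, x, v) at_top" using V(3) s(2) by auto
  then have "limitin X g p at_top"
    using continuous_map_limit[OF continuous_map_fst] by (fastforce simp: state_space_def o_def)
  then have "((\<lambda>t. \<phi> (g t)) \<longlongrightarrow> \<phi> p) at_top"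
    using continuous_map_limit[OF continuous_potential] by (fastforce simp: o_def)
  moreover have "\<forall>\<^sub>F t in at_top. \<phi> (g t) \<le> \<phi> (g 0)"
    using s(4) by (auto intro: eventually_mono[OF eventually_ge_at_top[of 0]])
  ultimately have "\<phi> p \<le> \<phi> (g 0)" by (intro tendsto_upperbound) auto
  then show False using s(3) by simp
qed

text \<open>An escaping trajectory confined near \<open>p\<close> would remain in a closed set on
  which \<open>\<phi>\<close> is at most a value below \<open>\<phi> p\<close>. No critical point
  lies in that set, which contradicts the convergence to the critical points.\<close>

lemma lyapunov_stable_imp_local_minimum:
  assumes eq: "(p, x, v) \<in> equilibria G X \<kappa> \<phi> uB kI"
    and stable: "lyapunov_stable (state_space X) Sol (p, x, v)"
    and val: "critical_value_locally_constant G X \<kappa> \<phi> p"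
  shows "local_minimum X \<phi> p"
proof (rule ccontr)
  assume nomin: "\<not> local_minimum X \<phi> p"
  obtain W where W: "openin X W" "p \<in> W" "\<And>q. q \<in> W \<Longrightarrow> q \<in> crit \<Longrightarrow> \<phi> q = \<phi> p"
    using val unfolding critical_value_locally_constant_def by blast
  \<comment> \<open>Regularity gives a closed neighbourhood \<open>C\<close> of \<open>p\<close>
    inside \<open>W\<close>. Thus \<open>K\<close> below is closed, and its complement is an open
    set around all critical points.\<close>
  have "neighbourhood_base_of (closedin X) X"
    using compact_Hausdorff_imp_regular_space[OF compact Hausdorff] neighbourhood_base_of_closedin by blast
  then obtain N C where N: "openin X N" "closedin X C" "p \<in> N" "N \<subseteq> C" "C \<subseteq> W"
    using W(1,2) unfolding neighbourhood_base_of by metis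
  have "openin (state_space X) (N \<times> UNIV)"
    unfolding state_space_def using N(1)
    by (simp add: openin_prod_Times_iff)
  moreover have "(p, x, v) \<in> N \<times> UNIV" using N by simp
  ultimately obtain V where V: "openin (state_space X) V" "(p, x, v) \<in> V" "\<forall>z0\<in>V. \<exists>\<zeta>\<in>Sol. \<zeta> 0 = z0"
    "\<forall>\<zeta>\<in>Sol. \<zeta> 0 \<in> V \<longrightarrow> (\<forall>t\<ge>0. \<zeta> t \<in> N \<times> UNIV)"
    using stable[unfolded lyapunov_stable_def, rule_format, of "N \<times> UNIV"] by blast
  obtain g \<xi> uI where s: "sol g \<xi> uI" "(g 0, \<xi> 0, uI 0) \<in> V" "\<phi> (g 0) < \<phi> p"
    "\<And>t. t \<ge> 0 \<Longrightarrow> \<phi> (g t) \<le> \<phi> (g 0)"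
    using escaping_trajectory[OF eq nomin V(1-3)] by blast
  have "(\<lambda>t. (g t, \<xi> t, uI t)) \<in> Sol" using s(1) unfolding closed_loop_trajectories_def by blast
  from V(4)[rule_format, OF this s(2)] have gN: "g t \<in> N" if "t \<ge> 0" for t using that by blast
  define K where "K = C \<inter> {r \<in> topspace X. \<phi> r \<in> {..\<phi> (g 0)}}"
  have "closedin X K"
    unfolding K_def using N(2) closedin_continuous_map_preimage[OF continuous_potential, of "{..\<phi> (g 0)}"]
    by (intro closedin_Int) auto
  then have "openin X (topspace X - K)" by (rule openin_diff[OF openin_topspace])
  moreover have "crit \<subseteq> topspace X - K"
  proof
    fix r assume r: "r \<in> crit"
    then have "r \<in> topspace X" using topspace_eq by (simp add: critical_points_def)
    moreover have "r \<notin> K" using W(3)[of r] r N(5) s(3) unfolding K_def by fastforce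
    ultimately show "r \<in> topspace X - K" by blast
  qed
  ultimately have "\<forall>\<^sub>F t in at_top. g t \<in> topspace X - K"
    using solution_tends_to_critical_points[OF s(1)] unfolding tends_to_set_def by blast
  with eventually_ge_at_top[of 0] have "\<forall>\<^sub>F t in at_top :: real filter. False"
  proof eventually_elim
    case (elim t)
    then have "g t \<in> K"
      using gN[of t] s(4)[of t] closed_loop_solution_in_carrier[OF s(1)] N(4) unfolding K_def by auto
    then show False using elim by blast
  qed
  then show False by simp
qed

end

text \<open>The claim on stable equilibria has two forms. Under asymptotic stability, convergence to
  the equilibrium fixes the limit of the potential; under Lyapunov stability, the locally constant
  critical value excludes nearby critical points of lower potential.\<close>

theorem proposition1:
  fixes G :: "('g, 'm) monoid_scheme"
    and X :: "'g topology"
    and A :: "('g, 'a::euclidean_space) chart set"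
    and U :: "'g set" and \<kappa> :: "'g \<Rightarrow> 'a"
    and \<phi> :: "'g \<Rightarrow> real" and g_target :: 'g
    and b kP :: real
    and uB :: "'g \<Rightarrow> 'a"
  assumes "compact_lie_group G X A"
    and "(U, \<kappa>) \<in> A" and "\<one>\<^bsub>G\<^esub> \<in> U"
    and "smooth_potential X A \<phi>"
    and "g_target \<in> carrier G" and "local_minimum X \<phi> g_target"
    and "kP > 0"
    and "has_bounded_left_gradient G X \<kappa> uB"
  shows "\<exists>KI>0. \<exists>KD>0. \<forall>kI kD. kI \<ge> KI \<and> kD - kI \<ge> KD \<longrightarrow>
    (\<forall>g \<xi> uI. closed_loop_solution G X \<kappa> \<phi> b uB kP kI kD g \<xi> uI \<longrightarrow>
       tends_to_set X g (critical_points G X \<kappa> \<phi>) at_top \<and>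
       (\<xi> \<longlongrightarrow> 0) at_top \<and>
       ((\<lambda>t. kI *\<^sub>R uI t + uB (g t)) \<longlongrightarrow> 0) at_top) \<and>
    (\<forall>p x v. (p, x, v) \<in> equilibria G X \<kappa> \<phi> uB kI \<longrightarrow>
       (let S = state_space X; Sol = closed_loop_trajectories G X \<kappa> \<phi> b uB kP kI kD in
          (asymptotically_stable S Sol (p, x, v) \<longrightarrow> local_minimum X \<phi> p) \<and>
          (lyapunov_stable S Sol (p, x, v) \<and> critical_value_locally_constant G X \<kappa> \<phi> p \<longrightarrow>
             local_minimum X \<phi> p)))"
proof -
  interpret compact_lie_group G X A by fact
  obtain D B where B: "\<And>p. p \<in> carrier G \<Longrightarrow> has_left_derivative G X \<kappa> uB (D p) p \<and> onorm (D p) \<le> B"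
    using assms(8) unfolding has_bounded_left_gradient_def by blast
  \<comment> \<open>The threshold for \<open>kD - kI\<close> in \<open>gains\<close>; it depends on
    \<open>b\<close> and the bias bound only and is uniform in \<open>kI \<ge> 1\<close>.\<close>
  let ?K = "\<bar>b\<bar> + (B + \<bar>b\<bar>)\<^sup>2 + 1"
  have loop: "pid_closed_loop G X A U \<kappa> \<phi> uB b kP kI kD B" if "kI \<ge> 1" "kD - kI \<ge> ?K" for kI kD
    by unfold_locales (use assms that B compact in auto)
  have "?K > 0" by (simp add: add_nonneg_pos)
  show ?thesis
  proof (intro exI conjI allI impI)
    show "(1::real) > 0" "?K > 0" using \<open>?K > 0\<close> by simp_all
    fix kI kD :: real assume K: "kI \<ge> 1 \<and> kD - kI \<ge> ?K"
    then interpret pid_closed_loop G X A U \<kappa> \<phi> uB b kP kI kD B using loop by blast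
    {
      fix g \<xi> uI assume "closed_loop_solution G X \<kappa> \<phi> b uB kP kI kD g \<xi> uI"
      then show "tends_to_set X g (critical_points G X \<kappa> \<phi>) at_top" "(\<xi> \<longlongrightarrow> 0) at_top"
        "((\<lambda>t. kI *\<^sub>R uI t + uB (g t)) \<longlongrightarrow> 0) at_top"
        by (rule solution_tends_to_critical_points solution_converges)+
    next
      fix p x v assume "(p, x, v) \<in> equilibria G X \<kappa> \<phi> uB kI"
      then show "let S = state_space X; Sol = closed_loop_trajectories G X \<kappa> \<phi> b uB kP kI kD in
          (asymptotically_stable S Sol (p, x, v) \<longrightarrow> local_minimum X \<phi> p) \<and>
          (lyapunov_stable S Sol (p, x, v) \<and> critical_value_locally_constant G X \<kappa> \<phi> p \<longrightarrow>
             local_minimum X \<phi> p)"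
        unfolding Let_def
        using asymptotically_stable_imp_local_minimum lyapunov_stable_imp_local_minimum by blast
    }
  qed
qed

end
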